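(* Let $X$ be a càdlàg process, $\mathcal{F}$ the right-continuous filtration associated to its natural filtration, $(X^n)_n$ a sequence of càdlàg processes and $(\mathcal{F}^n)_n$ their natural filtrations. Let $\gamma:[0,T]\times\mathbb{R}\to\mathbb{R}$ be bounded and continuous. Suppose that $X^n\to X$ in probability (for the Skorokhod topology), that Aldous' criterion for tightness holds, i.e. $$\forall \varepsilon>0,\quad \lim_{\delta\downarrow 0}\ \limsup_{n\to+\infty}\ \sup_{\sigma,\nu\in\mathcal{T}^n_T,\ \sigma\leqslant\nu\leqslant\sigma+\delta}\ \mathbb{P}\big[|X^n_\sigma-X^n_\nu|\geqslant\varepsilon\big]=0,$$ and that for all $n$, $\mathcal{F}^n\subset\mathcal{F}$ (i.e. $\mathcal{F}^n_t\subset\mathcal{F}_t$ for all $t\in[0,T]$). Then $$\limsup_{n\to\infty}\Gamma_n(T)\leqslant\Gamma(T),$$ where $\Gamma(T)=\sup_{\tau\in\mathcal{T}_T}\mathbb{E}[\gamma(\tau,X_\tau)]$ and $\Gamma_n(T)=\sup_{\tau\in\mathcal{T}^n_T}\mathbb{E}[\gamma(\tau,X^n_\tau)]$.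
   Context: $(\Omega,\mathcal{A},\mathbb{P})$ is a probability space on which all processes are defined, $T>0$ is fixed, all processes are real-valued and indexed by $[0,T]$, and all filtrations are indexed by $[0,T]$. $\mathbb{D}([0,T])$ is the space of càdlàg functions $[0,T]\to\mathbb{R}$ with the Skorokhod ($J_1$) topology; convergence in probability of càdlàg processes is for this topology. The natural filtration of a process $Y$ is $\mathcal{F}^Y_t=\sigma(Y_s,\,s\leqslant t)$. The right-continuous filtration associated to the natural filtration of $X$ is $\mathcal{F}_t=\mathcal{F}^X_{t^+}=\bigcap_{s>t}\mathcal{F}^X_s$ for $t<T$, with $\mathcal{F}_T=\mathcal{F}^X_T$. $\mathcal{T}_T$ (resp. $\mathcal{T}^n_T$) is the set of $\mathcal{F}$-stopping times (resp. $\mathcal{F}^n$-stopping times) bounded by $T$. *)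

theory Defs
  imports "HOL-Probability.Probability"
begin

text \<open>
  A process is a function \<open>Y :: real \<Rightarrow> 'a \<Rightarrow> real\<close>, time first. Its values at times outside
  \<open>{0..T}\<close> and at points outside \<open>space M\<close> are unconstrained and have no effect on the notions below;
  \<open>natural_filtration\<close> is of interest at times in \<open>{0..T}\<close> only.
\<close>

definition cadlag_on :: "real \<Rightarrow> (real \<Rightarrow> real) \<Rightarrow> bool" where
  "cadlag_on T x \<longleftrightarrow>
     (\<forall>t\<in>{0..<T}. (x \<longlongrightarrow> x t) (at_right t)) \<and>
     (\<forall>t\<in>{0<..T}. \<exists>l. (x \<longlongrightarrow> l) (at_left t))"

definition cadlag_process :: "'a measure \<Rightarrow> real \<Rightarrow> (real \<Rightarrow> 'a \<Rightarrow> real) \<Rightarrow> bool" where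
  "cadlag_process M T Y \<longleftrightarrow>
     (\<forall>t\<in>{0..T}. Y t \<in> borel_measurable M) \<and>
     (\<forall>\<omega>\<in>space M. cadlag_on T (\<lambda>t. Y t \<omega>))"

definition time_changes :: "real \<Rightarrow> (real \<Rightarrow> real) set" where
  "time_changes T =
     {l. strict_mono_on {0..T} l \<and> continuous_on {0..T} l \<and> l ` {0..T} = {0..T}}"

text \<open>
  Skorokhod's metric for the \<open>J\<^sub>1\<close> topology, in Billingsley's form: the infimum of the \<open>r\<close> for which
  some time change \<open>l\<close> satisfies \<open>sup \<bar>l t - t\<bar> \<le> r\<close> and \<open>sup \<bar>x t - y (l t)\<bar> \<le> r\<close>. Cadlag functions
  on a compact interval are bounded, so the infimum is over a nonempty set when
  \<open>x\<close> and \<open>y\<close> are cadlag.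
\<close>

definition skorokhod_dist :: "real \<Rightarrow> (real \<Rightarrow> real) \<Rightarrow> (real \<Rightarrow> real) \<Rightarrow> real" where
  "skorokhod_dist T x y =
     Inf {r. 0 \<le> r \<and> (\<exists>l\<in>time_changes T. \<forall>t\<in>{0..T}. \<bar>l t - t\<bar> \<le> r \<and> \<bar>x t - y (l t)\<bar> \<le> r)}"

definition skorokhod_tendsto_in_prob ::
    "'a measure \<Rightarrow> real \<Rightarrow> (nat \<Rightarrow> real \<Rightarrow> 'a \<Rightarrow> real) \<Rightarrow> (real \<Rightarrow> 'a \<Rightarrow> real) \<Rightarrow> bool" where
  "skorokhod_tendsto_in_prob M T Xn X \<longleftrightarrow>
     (\<forall>\<epsilon>>0. (\<lambda>n. measure M {\<omega>\<in>space M.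
        \<epsilon> \<le> skorokhod_dist T (\<lambda>t. Xn n t \<omega>) (\<lambda>t. X t \<omega>)}) \<longlonglongrightarrow> 0)"

definition natural_filtration :: "'a measure \<Rightarrow> (real \<Rightarrow> 'a \<Rightarrow> real) \<Rightarrow> real \<Rightarrow> 'a measure" where
  "natural_filtration M Y t =
     sigma (space M) {Y s -` B \<inter> space M | s B. s \<in> {0..t} \<and> B \<in> sets borel}"

text \<open>The intersection is already a \<open>\<sigma>\<close>-algebra; \<open>sigma\<close> only packages it as a measure.\<close>

definition right_cont_filtration ::
    "'a measure \<Rightarrow> real \<Rightarrow> (real \<Rightarrow> 'a \<Rightarrow> real) \<Rightarrow> real \<Rightarrow> 'a measure" where
  "right_cont_filtration M T Y t =
     (if t < T then sigma (space M) (\<Inter>s\<in>{t<..T}. sets (natural_filtration M Y s))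
      else natural_filtration M Y T)"

text \<open>
  The library notion \<open>stopping_time\<close> quantifies over all real \<open>t\<close>. Since \<open>\<tau>\<close> takes values in
  \<open>{0..T}\<close>, its condition is vacuous outside \<open>{0..T}\<close>: the event \<open>\<tau> \<le> t\<close> is empty for
  \<open>t < 0\<close> and the whole space for \<open>t > T\<close>.
\<close>

definition stopping_times_upto ::
    "'a measure \<Rightarrow> real \<Rightarrow> (real \<Rightarrow> 'a measure) \<Rightarrow> ('a \<Rightarrow> real) set" where
  "stopping_times_upto M T F = {\<tau>. stopping_time F \<tau> \<and> (\<forall>\<omega>\<in>space M. \<tau> \<omega> \<in> {0..T})}"

text \<open>
  Suprema and upper limits are taken in \<open>ereal\<close>; for a bounded reward they are those of the reals.
\<close>

definition aldous_criterion :: "'a measure \<Rightarrow> real \<Rightarrow> (nat \<Rightarrow> real \<Rightarrow> 'a \<Rightarrow> real) \<Rightarrow> bool" where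
  "aldous_criterion M T Xn \<longleftrightarrow>
     (\<forall>\<epsilon>>0. ((\<lambda>\<delta>. limsup (\<lambda>n.
        SUP (\<sigma>, \<nu>) \<in> {(\<sigma>, \<nu>).
            \<sigma> \<in> stopping_times_upto M T (natural_filtration M (Xn n)) \<and>
            \<nu> \<in> stopping_times_upto M T (natural_filtration M (Xn n)) \<and>
            (\<forall>\<omega>\<in>space M. \<sigma> \<omega> \<le> \<nu> \<omega> \<and> \<nu> \<omega> \<le> \<sigma> \<omega> + \<delta>)}.
          ereal (measure M {\<omega>\<in>space M. \<epsilon> \<le> \<bar>Xn n (\<sigma> \<omega>) \<omega> - Xn n (\<nu> \<omega>) \<omega>\<bar>})))
        \<longlongrightarrow> 0) (at_right (0::real)))"

definition optimal_value ::
    "'a measure \<Rightarrow> real \<Rightarrow> (real \<Rightarrow> 'a measure) \<Rightarrow> (real \<times> real \<Rightarrow> real) \<Rightarrow>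
     (real \<Rightarrow> 'a \<Rightarrow> real) \<Rightarrow> ereal" where
  "optimal_value M T F \<gamma> Y =
     (SUP \<tau> \<in> stopping_times_upto M T F. ereal (\<integral>\<omega>. \<gamma> (\<tau> \<omega>, Y (\<tau> \<omega>) \<omega>) \<partial>M))"

end

theory Submission
  imports Defs
begin

text \<open>
  A near-optimal \<open>\<F>\<^sup>n\<close>-stopping time \<open>\<tau>\<close> is also an \<open>\<F>\<close>-stopping time, so its reward along \<open>X\<close> is at
  most \<open>\<Gamma>(T)\<close>. Its reward along \<open>X\<^sup>n\<close> may nevertheless be far from that along \<open>X\<close>: Skorokhod
  convergence says nothing about the gap between the two paths at a single random time, which may
  sit next to a jump. The remedy is to stop a little later, at \<open>\<nu>\<^sub>u = min (\<tau> + u) T\<close>, with \<open>u\<close> uniform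
  on a short interval \<open>[0, \<delta>]\<close> and independent of everything else.

  For each fixed \<open>u\<close>, \<open>\<nu>\<^sub>u\<close> is again a stopping time of both filtrations
  (\<open>delayed_stopping_time\<close>, \<open>stopping_times_upto_mono\<close>), so its reward along \<open>X\<close> is still at most
  \<open>\<Gamma>(T)\<close>. Two approximations close the argument.

  \<^item> Delaying costs little along \<open>X\<^sup>n\<close>, uniformly in the stopping time and in \<open>u \<le> \<delta>\<close>. This is
    Aldous' criterion; the reward is only uniformly continuous on compact sets, so it is combined
    with the tightness of \<open>sup \<bar>X\<^sup>n\<bar>\<close> (\<open>aldous_reward_insensitive_to_delay\<close>).

  \<^item> After averaging over \<open>u\<close>, replacing \<open>X\<^sup>n\<close> by \<open>X\<close> costs little. A cadlag path is
    almost constant between the points of some finite grid; hence a path at Skorokhod distance less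
    than \<open>\<kappa>\<close> is uniformly close to it except at times within \<open>\<kappa>\<close> of the grid, and \<open>\<tau> + u\<close> hits
    these times with probability of order \<open>\<kappa> / \<delta>\<close>, whatever \<open>\<tau>\<close> is
    (\<open>averaged_reward_modulus\<close>). The admissible \<open>\<kappa>\<close> depends on the path of \<open>X\<close> but not on \<open>n\<close>,
    which is enough for convergence in probability to pass to expectations
    (\<open>expectation_tendsto_0_of_pathwise_modulus\<close>).

  Fubini's theorem for \<open>u\<close> and \<open>\<omega>\<close> combines the two. It needs joint measurability of cadlag
  processes in time and chance (\<open>cadlag_process_jointly_measurable\<close>).

  A separate point is that \<open>measure\<close> vanishes on non-measurable sets, so that convergence in
  probability carries information only once the Skorokhod distance of two cadlag processes is known to
  be a random variable. It is the limit of the distances between discretised paths, each of which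
  takes countably many values (\<open>skorokhod_dist_measurable\<close>).
\<close>

section \<open>Cadlag paths\<close>

definition grid :: "real \<Rightarrow> (nat \<Rightarrow> real) \<Rightarrow> nat \<Rightarrow> bool" where
  "grid t s m \<longleftrightarrow> s 0 = 0 \<and> s m = t \<and> (\<forall>i<m. s i < s (Suc i))"

lemma grid_snoc:
  assumes "grid a s m" "a < b"
  shows "grid b (s(Suc m := b)) (Suc m)"
  using assms by (auto simp: grid_def less_Suc_eq)

lemma grid_less:
  assumes "grid t s m" "i < j" "j \<le> m"
  shows "s i < s j"
  using assms(2,3)
proof (induction j)
  case (Suc j)
  have "s j < s (Suc j)" using assms(1) Suc.prems by (auto simp: grid_def)
  then show ?case using Suc by (cases "i = j") auto
qed simp

lemma grid_mono:
  assumes "grid t s m" "i \<le> j" "j \<le> m"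
  shows "s i \<le> s j"
  using grid_less[OF assms(1), of i j] assms by (cases "i = j") auto

lemma grid_bounds:
  assumes "grid t s m" "i \<le> m"
  shows "0 \<le> s i" "s i \<le> t"
  using grid_mono[OF assms(1), of 0 i] grid_mono[OF assms(1), of i m] assms
  by (auto simp: grid_def)

lemma grid_cell:
  assumes "grid t s m" "0 \<le> u" "u < t"
  obtains i where "i < m" "s i \<le> u" "u < s (Suc i)"
proof -
  have "\<exists>i<m. s i \<le> u \<and> u < s (Suc i)"
    using assms
  proof (induction m arbitrary: t)
    case (Suc m)
    have "grid (s m) s m" using Suc.prems by (auto simp: grid_def)
    then show ?case
      using Suc by (cases "u < s m") (auto simp: grid_def intro: less_SucI)
  qed (auto simp: grid_def)
  then show ?thesis using that by blast
qed

text \<open>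
  The supremum \<open>c\<close> of the times up to which such a grid exists is itself such a time, because the left
  limit at \<open>c\<close> makes the path almost constant just before \<open>c\<close>; and if \<open>c\<close> were less than \<open>T\<close>, right
  continuity at \<open>c\<close> would allow one more cell. The bound on \<open>\<bar>u - v\<bar>\<close> lets a time change that maps
  cells to cells be controlled without looking inside a cell.
\<close>
lemma cadlag_partition:
  assumes x: "cadlag_on T x" and T: "T > 0" and e: "e > 0"
  obtains s m where "grid T s m"
    "\<And>i u v. i < m \<Longrightarrow> u \<in> {s i..<s (Suc i)} \<Longrightarrow> v \<in> {s i..<s (Suc i)} \<Longrightarrow>
       \<bar>x u - x v\<bar> \<le> e \<and> \<bar>u - v\<bar> \<le> e"
proof -
  define flat where "flat a b \<longleftrightarrow>
    (\<forall>u\<in>{a..<b}. \<forall>v\<in>{a..<b}. \<bar>x u - x v\<bar> \<le> e \<and> \<bar>u - v\<bar> \<le> e)" for a b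
  define reach where "reach t \<longleftrightarrow>
    (\<exists>s m. grid t s m \<and> (\<forall>i<m. flat (s i) (s (Suc i))))" for t
  have reach0: "reach 0"
    unfolding reach_def by (rule exI[of _ "\<lambda>_. 0"], rule exI[of _ 0]) (simp add: grid_def)
  have step: "reach b" if ra: "reach a" and "a < b" "flat a b" for a b
  proof -
    obtain s m where s: "grid a s m" "\<forall>i<m. flat (s i) (s (Suc i))"
      using ra by (auto simp: reach_def)
    have "flat ((s(Suc m := b)) i) ((s(Suc m := b)) (Suc i))" if "i < Suc m" for i
      using that s \<open>flat a b\<close> by (cases "i = m") (auto simp: grid_def)
    then show ?thesis using grid_snoc[OF s(1) \<open>a < b\<close>] unfolding reach_def by blast
  qed
  define A where "A = {t\<in>{0..T}. reach t}"
  define c where "c = Sup A"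
  have A0: "0 \<in> A" and bdd: "bdd_above A" using reach0 T by (auto simp: A_def bdd_above_def)
  have "0 \<le> c" using A0 bdd by (simp add: c_def cSup_upper)
  have "c \<le> T" unfolding c_def by (rule cSup_least) (use A0 in \<open>auto simp: A_def\<close>)
  have rc: "reach c"
  proof (cases "c = 0")
    case False
    then have "c \<in> {0<..T}" using \<open>0 \<le> c\<close> \<open>c \<le> T\<close> by auto
    then obtain l where "(x \<longlongrightarrow> l) (at_left c)"
      using x unfolding cadlag_on_def by blast
    then have "\<forall>\<^sub>F u in at_left c. dist (x u) l < e / 2"
      using e by (intro tendstoD) auto
    then obtain a where a: "a < c" "\<And>u. a < u \<Longrightarrow> u < c \<Longrightarrow> \<bar>x u - l\<bar> < e / 2"
      by (auto simp: eventually_at_left_field dist_real_def)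
    have "max a (c - e) < Sup A" using a e by (auto simp: c_def[symmetric])
    then obtain p where p: "p \<in> A" "max a (c - e) < p"
      using less_cSup_iff[of A] A0 bdd by blast
    have "p \<le> c" using p bdd by (simp add: c_def cSup_upper)
    show ?thesis
    proof (cases "p = c")
      case False
      have "\<bar>x u - x v\<bar> \<le> e \<and> \<bar>u - v\<bar> \<le> e" if "u \<in> {p..<c}" "v \<in> {p..<c}" for u v
      proof -
        have "\<bar>x u - l\<bar> < e / 2" "\<bar>x v - l\<bar> < e / 2" using a(2) that p(2) by auto
        moreover have "\<bar>u - v\<bar> \<le> e" using that p(2) by auto
        ultimately show ?thesis by linarith
      qed
      then have "flat p c" by (auto simp: flat_def)
      then show ?thesis using step[of p c] p \<open>p \<le> c\<close> False by (auto simp: A_def)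
    qed (use p in \<open>auto simp: A_def\<close>)
  qed (use reach0 in simp)
  have "c = T"
  proof (rule ccontr)
    assume "c \<noteq> T"
    then have "c < T" using \<open>c \<le> T\<close> by simp
    then have "(x \<longlongrightarrow> x c) (at_right c)" using x \<open>0 \<le> c\<close> by (auto simp: cadlag_on_def)
    then have "\<forall>\<^sub>F u in at_right c. dist (x u) (x c) < e / 2"
      using e by (intro tendstoD) auto
    then obtain b where b: "b > c" "\<And>u. c < u \<Longrightarrow> u < b \<Longrightarrow> \<bar>x u - x c\<bar> < e / 2"
      by (auto simp: eventually_at_right_field dist_real_def)
    define d where "d = min b (min T (c + e))"
    have d: "c < d" "d \<le> b" "d \<le> T" "d \<le> c + e"
      using b e \<open>c < T\<close> by (auto simp: d_def)
    have near: "\<bar>x u - x c\<bar> < e / 2" if "u \<in> {c..<d}" for u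
      using b(2)[of u] d e that by (cases "u = c") auto
    have "\<bar>x u - x v\<bar> \<le> e \<and> \<bar>u - v\<bar> \<le> e" if "u \<in> {c..<d}" "v \<in> {c..<d}" for u v
    proof -
      have "\<bar>u - v\<bar> \<le> e" using that d by auto
      then show ?thesis using near[OF that(1)] near[OF that(2)] by linarith
    qed
    then have "reach d" using step[OF rc d(1)] by (auto simp: flat_def)
    then have "d \<in> A" using d \<open>0 \<le> c\<close> by (auto simp: A_def)
    then have "d \<le> c" using bdd by (simp add: c_def cSup_upper)
    then show False using d by simp
  qed
  then obtain s m where "grid T s m" "\<forall>i<m. flat (s i) (s (Suc i))"
    using rc by (auto simp: reach_def)
  then show ?thesis using that[of s m] by (auto simp: flat_def)
qed

lemma cadlag_bounded:
  assumes "cadlag_on T x" "T > 0"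
  obtains K where "\<And>t. t \<in> {0..T} \<Longrightarrow> \<bar>x t\<bar> \<le> K"
proof -
  obtain s m where s: "grid T s m" and
    osc: "\<And>i u v. i < m \<Longrightarrow> u \<in> {s i..<s (Suc i)} \<Longrightarrow> v \<in> {s i..<s (Suc i)} \<Longrightarrow>
       \<bar>x u - x v\<bar> \<le> 1 \<and> \<bar>u - v\<bar> \<le> 1"
    using cadlag_partition[OF assms, of 1] by auto
  have le: "\<bar>x (s i)\<bar> \<le> (\<Sum>i\<le>m. \<bar>x (s i)\<bar>)" if "i \<le> m" for i
    using that by (intro member_le_sum) auto
  have "\<bar>x t\<bar> \<le> (\<Sum>i\<le>m. \<bar>x (s i)\<bar>) + 1" if t: "t \<in> {0..T}" for t
  proof (cases "t = T")
    case True
    then show ?thesis using le[of m] s by (auto simp: grid_def)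
  next
    case False
    then obtain i where i: "i < m" "s i \<le> t" "t < s (Suc i)"
      using grid_cell[OF s, of t] t by auto
    then show ?thesis using osc[of i t "s i"] le[of i] by auto
  qed
  then show ?thesis using that by blast
qed

text \<open>
  Right continuity turns the uncountable condition \<open>sup \<bar>x\<bar> \<le> K\<close> into a countable one, hence into an
  event. The endpoint \<open>T\<close> has no points to its right and is listed explicitly.
\<close>
lemma cadlag_bound_from_rationals:
  assumes x: "cadlag_on T x" and T: "T > 0"
    and le: "\<And>q. q \<in> insert T (\<rat> \<inter> {0..T}) \<Longrightarrow> \<bar>x q\<bar> \<le> K"
    and t: "t \<in> {0..T}"
  shows "\<bar>x t\<bar> \<le> K"
proof (rule ccontr)
  assume neg: "\<not> \<bar>x t\<bar> \<le> K"
  then have "t < T" using le[of T] t by (cases "t = T") auto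
  then have "((\<lambda>u. \<bar>x u\<bar>) \<longlongrightarrow> \<bar>x t\<bar>) (at_right t)"
    using x t by (auto simp: cadlag_on_def intro!: tendsto_rabs)
  then have "\<forall>\<^sub>F u in at_right t. \<bar>x u\<bar> > K" by (rule order_tendstoD) (use neg in auto)
  then obtain b where b: "b > t" "\<And>u. t < u \<Longrightarrow> u < b \<Longrightarrow> \<bar>x u\<bar> > K"
    by (auto simp: eventually_at_right_field)
  obtain q where "q \<in> \<rat>" "t < q" "q < min b T"
    using Rats_dense_in_real[of t "min b T"] b \<open>t < T\<close> by auto
  then show False using le[of q] b(2)[of q] t by auto
qed

section \<open>Time changes and the Skorokhod distance\<close>

lemma time_change_mem:
  assumes "l \<in> time_changes T" "t \<in> {0..T}"
  shows "l t \<in> {0..T}"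
  using assms by (auto simp: time_changes_def)

lemma time_change_end:
  assumes l: "l \<in> time_changes T" and T: "T > 0"
  shows "l T = T"
proof -
  obtain t where t: "t \<in> {0..T}" "l t = T"
    using l T by (auto simp: time_changes_def image_iff set_eq_iff) (metis atLeastAtMost_iff order.refl less_imp_le)
  have "l t < l T" if "t < T"
    using l t that T by (auto simp: time_changes_def strict_mono_on_def)
  then show ?thesis using t time_change_mem[OF l, of T] T by (cases "t = T") auto
qed

lemma id_time_change: "T > 0 \<Longrightarrow> (\<lambda>t. t) \<in> time_changes T"
  by (auto simp: time_changes_def strict_mono_on_def)

lemma time_change_comp:
  assumes "l \<in> time_changes T" "l' \<in> time_changes T"
  shows "(\<lambda>t. l' (l t)) \<in> time_changes T"
proof -
  have im: "l ` {0..T} = {0..T}" "l' ` {0..T} = {0..T}" using assms by (auto simp: time_changes_def)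
  have "continuous_on {0..T} (\<lambda>t. l' (l t))"
    by (rule continuous_on_compose2[where t = "{0..T}"]) (use assms in \<open>auto simp: time_changes_def\<close>)
  moreover have "(\<lambda>t. l' (l t)) ` {0..T} = {0..T}" using im by (metis image_image)
  moreover have "strict_mono_on {0..T} (\<lambda>t. l' (l t))"
    using assms time_change_mem[OF assms(1)]
    by (simp add: time_changes_def strict_mono_on_def)
  ultimately show ?thesis by (simp add: time_changes_def)
qed

text \<open>
  The piecewise linear interpolation of \<open>r i \<mapsto> s i\<close>, built by appending one affine piece at a time.
\<close>
lemma grid_time_change:
  assumes "grid T r m" "grid T s m"
  obtains l where "l \<in> time_changes T"
    "\<And>i t. i < m \<Longrightarrow> t \<in> {r i..<r (Suc i)} \<Longrightarrow> l t \<in> {s i..<s (Suc i)}"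
proof -
  have "\<exists>l. strict_mono_on {0..a} l \<and> continuous_on {0..a} l \<and> l 0 = 0 \<and> l a = b \<and>
          (\<forall>i<m. \<forall>t\<in>{r i..<r (Suc i)}. l t \<in> {s i..<s (Suc i)})"
    if "grid a r m" "grid b s m" for a b m
    using that
  proof (induction m arbitrary: a b)
    case 0
    then show ?case by (intro exI[of _ "\<lambda>t. t"]) (auto simp: grid_def strict_mono_on_def)
  next
    case (Suc m)
    have gr: "grid (r m) r m" and gs: "grid (s m) s m" using Suc.prems by (auto simp: grid_def)
    obtain l where l: "strict_mono_on {0..r m} l" "continuous_on {0..r m} l" "l 0 = 0" "l (r m) = s m"
      "\<forall>i<m. \<forall>t\<in>{r i..<r (Suc i)}. l t \<in> {s i..<s (Suc i)}"
      using Suc.IH[OF gr gs] by blast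
    have lt: "r m < a" "s m < b" "a = r (Suc m)" "b = s (Suc m)" using Suc.prems by (auto simp: grid_def)
    have r0: "0 \<le> r m" using grid_bounds[OF gr, of m] by simp
    define k where "k = (b - s m) / (a - r m)"
    have k: "k > 0" "k * (a - r m) = b - s m" using lt by (auto simp: k_def)
    define l' where "l' t = (if t \<le> r m then l t else s m + k * (t - r m))" for t
    have up: "l' t < s m" if "t \<in> {0..<r m}" for t
      using l(1,4) that r0 strict_mono_onD[OF l(1), of t "r m"] by (auto simp: l'_def)
    have "strict_mono_on {0..a} l'"
      unfolding strict_mono_on_def
    proof safe
      fix u v :: real assume uv: "u \<in> {0..a}" "v \<in> {0..a}" "u < v"
      consider "v \<le> r m" | "u \<le> r m" "r m < v" | "r m < u" by linarith
      then show "l' u < l' v"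
      proof cases
        case 1
        then show ?thesis using l(1) uv by (auto simp: l'_def strict_mono_on_def)
      next
        case 2
        have "l' u \<le> s m" using up[of u] uv 2 l(4) by (cases "u = r m") (auto simp: l'_def)
        then show ?thesis using 2 k(1) by (auto simp: l'_def intro: le_less_trans)
      next
        case 3
        then show ?thesis using k(1) uv by (auto simp: l'_def)
      qed
    qed
    moreover have "continuous_on {0..a} l'"
    proof -
      have "continuous_on ({0..r m} \<union> {r m..a}) (\<lambda>t. if t \<le> r m then l t else s m + k * (t - r m))"
        by (rule continuous_on_If) (use l in \<open>auto intro!: continuous_intros\<close>)
      moreover have "{0..r m} \<union> {r m..a} = {0..a}" using r0 lt by auto
      ultimately show ?thesis by (simp add: l'_def[abs_def])
    qed
    moreover have "l' 0 = 0" using l r0 by (simp add: l'_def)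
    moreover have "l' a = b" using lt k by (simp add: l'_def)
    moreover have "l' t \<in> {s i..<s (Suc i)}" if "i < Suc m" "t \<in> {r i..<r (Suc i)}" for i t
    proof (cases "i = m")
      case True
      have "k * (t - r m) < k * (a - r m)" using k(1) that True lt by simp
      then have "s m + k * (t - r m) < b" using k(2) by linarith
      then show ?thesis using True that l(4) k(1) lt by (auto simp: l'_def)
    next
      case False
      then have "i < m" "r (Suc i) \<le> r m" using that grid_mono[OF gr, of "Suc i" m] by auto
      then show ?thesis using that l(5) by (auto simp: l'_def)
    qed
    ultimately show ?case by blast
  qed
  from this[OF assms] obtain l where l: "strict_mono_on {0..T} l" "continuous_on {0..T} l"
      "l 0 = 0" "l T = T" "\<forall>i<m. \<forall>t\<in>{r i..<r (Suc i)}. l t \<in> {s i..<s (Suc i)}"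
    by blast
  have "l ` {0..T} = {0..T}"
  proof
    have mono: "l u \<le> l v" if "u \<in> {0..T}" "v \<in> {0..T}" "u \<le> v" for u v
      using l(1) that by (cases "u = v") (auto simp: strict_mono_on_def intro: less_imp_le)
    show "l ` {0..T} \<subseteq> {0..T}"
      using mono[of 0] mono[of _ T] l(3,4) by fastforce
    show "{0..T} \<subseteq> l ` {0..T}"
    proof
      fix y assume "y \<in> {0..T}"
      then show "y \<in> l ` {0..T}"
        using IVT'[of l 0 y T] l by force
    qed
  qed
  then show ?thesis using that l by (auto simp: time_changes_def)
qed

lemma skorokhod_dist_le:
  assumes "0 \<le> r" "l \<in> time_changes T"
    "\<And>t. t \<in> {0..T} \<Longrightarrow> \<bar>l t - t\<bar> \<le> r \<and> \<bar>x t - y (l t)\<bar> \<le> r"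
  shows "skorokhod_dist T x y \<le> r"
  unfolding skorokhod_dist_def
  by (rule cInf_lower) (use assms in \<open>auto intro!: bdd_belowI[of _ 0] bexI[of _ l]\<close>)

text \<open>
  The common bound \<open>K\<close> makes the set in the definition of \<open>skorokhod_dist\<close> nonempty, by way of the
  identity time change; the infimum of the empty set would carry no information.
\<close>
lemma skorokhod_dist_lessD:
  assumes T: "T > 0" and bd: "\<And>t. t \<in> {0..T} \<Longrightarrow> \<bar>x t\<bar> \<le> K" "\<And>t. t \<in> {0..T} \<Longrightarrow> \<bar>y t\<bar> \<le> K"
    and "skorokhod_dist T x y < r"
  obtains l where "l \<in> time_changes T"
    "\<And>t. t \<in> {0..T} \<Longrightarrow> \<bar>l t - t\<bar> < r \<and> \<bar>x t - y (l t)\<bar> < r"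
proof -
  let ?S = "{r. 0 \<le> r \<and> (\<exists>l\<in>time_changes T. \<forall>t\<in>{0..T}. \<bar>l t - t\<bar> \<le> r \<and> \<bar>x t - y (l t)\<bar> \<le> r)}"
  have "0 \<le> K" using bd(1)[of 0] T by auto
  moreover have "\<bar>x t - y t\<bar> \<le> 2 * K" if "t \<in> {0..T}" for t using bd[OF that] by linarith
  ultimately have "2 * K \<in> ?S" using id_time_change[OF T] by (auto intro!: bexI[of _ "\<lambda>t. t"])
  then obtain r' where "r' \<in> ?S" "r' < r"
    using cInf_lessD[of ?S r] assms(4) unfolding skorokhod_dist_def by blast
  then show ?thesis using that by fastforce
qed

lemma skorokhod_dist_cong:
  assumes "\<And>t. t \<in> {0..T} \<Longrightarrow> x t = x' t" "\<And>t. t \<in> {0..T} \<Longrightarrow> y t = y' t"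
  shows "skorokhod_dist T x y = skorokhod_dist T x' y'"
proof -
  have "(\<forall>t\<in>{0..T}. \<bar>l t - t\<bar> \<le> r \<and> \<bar>x t - y (l t)\<bar> \<le> r) \<longleftrightarrow>
        (\<forall>t\<in>{0..T}. \<bar>l t - t\<bar> \<le> r \<and> \<bar>x' t - y' (l t)\<bar> \<le> r)" if "l \<in> time_changes T" for l r
    using assms time_change_mem[OF that] by auto
  then show ?thesis unfolding skorokhod_dist_def by (metis (no_types, lifting))
qed

lemma skorokhod_dist_triangle:
  assumes T: "T > 0" and "\<And>t. t \<in> {0..T} \<Longrightarrow> \<bar>x t\<bar> \<le> K" "\<And>t. t \<in> {0..T} \<Longrightarrow> \<bar>y t\<bar> \<le> K"
    "\<And>t. t \<in> {0..T} \<Longrightarrow> \<bar>z t\<bar> \<le> K"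
  shows "skorokhod_dist T x z \<le> skorokhod_dist T x y + skorokhod_dist T y z"
proof (rule field_le_epsilon)
  fix e :: real assume e: "e > 0"
  let ?a = "skorokhod_dist T x y + e / 2" and ?b = "skorokhod_dist T y z + e / 2"
  obtain l where l: "l \<in> time_changes T"
    "\<And>t. t \<in> {0..T} \<Longrightarrow> \<bar>l t - t\<bar> < ?a \<and> \<bar>x t - y (l t)\<bar> < ?a"
    using skorokhod_dist_lessD[of T x K y ?a] assms e by auto
  obtain l' where l': "l' \<in> time_changes T"
    "\<And>t. t \<in> {0..T} \<Longrightarrow> \<bar>l' t - t\<bar> < ?b \<and> \<bar>y t - z (l' t)\<bar> < ?b"
    using skorokhod_dist_lessD[of T y K z ?b] assms e by auto
  have *: "\<bar>l' (l t) - t\<bar> \<le> ?a + ?b \<and> \<bar>x t - z (l' (l t))\<bar> \<le> ?a + ?b" if "t \<in> {0..T}" for t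
    using l(2)[OF that] l'(2)[OF time_change_mem[OF l(1) that]] by linarith
  have "0 \<le> ?a + ?b" using *[of 0] T by auto
  then have "skorokhod_dist T x z \<le> ?a + ?b"
    by (rule skorokhod_dist_le[OF _ time_change_comp[OF l(1) l'(1)]]) (use * in auto)
  then show "skorokhod_dist T x z \<le> skorokhod_dist T x y + skorokhod_dist T y z + e" by simp
qed

text \<open>
  Two paths that match cell by cell along grids with equally many cells are close. The hypotheses
  are symmetric in the two paths, so that both \<open>skorokhod_dist T x y\<close> and \<open>skorokhod_dist T y x\<close> can
  be bounded in this way.
\<close>
lemma skorokhod_dist_le_of_grids:
  assumes T: "T > 0" and r: "grid T r m" and s: "grid T s m" and "\<bar>x T - y T\<bar> \<le> e"
    and cell: "\<And>i u v. i < m \<Longrightarrow> u \<in> {r i..<r (Suc i)} \<Longrightarrow> v \<in> {s i..<s (Suc i)} \<Longrightarrow>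
      \<bar>x u - y v\<bar> \<le> e \<and> \<bar>u - v\<bar> \<le> e"
  shows "skorokhod_dist T x y \<le> e"
proof -
  obtain l where l: "l \<in> time_changes T"
    "\<And>i t. i < m \<Longrightarrow> t \<in> {r i..<r (Suc i)} \<Longrightarrow> l t \<in> {s i..<s (Suc i)}"
    using grid_time_change[OF r s] by blast
  have "0 \<le> e" using assms(4) by linarith
  then show ?thesis
  proof (rule skorokhod_dist_le[OF _ l(1)])
    fix t assume t: "t \<in> {0..T}"
    show "\<bar>l t - t\<bar> \<le> e \<and> \<bar>x t - y (l t)\<bar> \<le> e"
    proof (cases "t = T")
      case True
      then show ?thesis using time_change_end[OF l(1) T] assms(4) \<open>0 \<le> e\<close> by simp
    next
      case False
      then obtain i where i: "i < m" "r i \<le> t" "t < r (Suc i)"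
        using grid_cell[OF r, of t] t by auto
      then show ?thesis using cell[OF i(1) _ l(2)[OF i(1), of t], of t] by (auto simp: abs_minus_commute)
    qed
  qed
qed

section \<open>Measurability of the Skorokhod distance\<close>

text \<open>
  The path is sampled at the multiples of \<open>T / k\<close> and its values are rounded down to multiples of
  \<open>1 / k\<close>; thus the discretised path on \<open>{0..T}\<close> is determined by \<open>k + 1\<close> integers.
\<close>
definition discretise :: "real \<Rightarrow> nat \<Rightarrow> (real \<Rightarrow> real) \<Rightarrow> real \<Rightarrow> real" where
  "discretise T k x t = real_of_int \<lfloor>k * x (T * real_of_int \<lfloor>k * t / T\<rfloor> / k)\<rfloor> / k"

lemma floor_scaled_dist:
  assumes "k > 0"
  shows "\<bar>real_of_int \<lfloor>real k * y\<rfloor> / k - y\<bar> \<le> 1 / k"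
proof -
  have "\<bar>\<lfloor>real k * y\<rfloor> - real k * y\<bar> \<le> 1" by linarith
  then have "\<bar>\<lfloor>real k * y\<rfloor> - real k * y\<bar> / k \<le> 1 / k" by (simp add: divide_right_mono)
  also have "\<bar>\<lfloor>real k * y\<rfloor> - real k * y\<bar> / k = \<bar>(\<lfloor>real k * y\<rfloor> - real k * y) / k\<bar>" by simp
  also have "(\<lfloor>real k * y\<rfloor> - real k * y) / k = \<lfloor>real k * y\<rfloor> / k - y"
    using assms by (simp add: field_simps)
  finally show ?thesis .
qed

lemma grid_point_bounds:
  assumes "k > 0" "T > 0" "t \<in> {0..T}"
  shows "T * real_of_int \<lfloor>real k * t / T\<rfloor> / k \<in> {0..T}" "0 \<le> \<lfloor>real k * t / T\<rfloor>" "nat \<lfloor>real k * t / T\<rfloor> \<le> k"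
proof -
  have 1: "0 \<le> real k * t / T" "real k * t / T \<le> k" using assms by (auto simp: field_simps)
  show 2: "0 \<le> \<lfloor>real k * t / T\<rfloor>" "nat \<lfloor>real k * t / T\<rfloor> \<le> k" using 1 by linarith+
  have "real_of_int \<lfloor>real k * t / T\<rfloor> \<le> k" using 1 by linarith
  then have "T * real_of_int \<lfloor>real k * t / T\<rfloor> \<le> T * k" using assms by simp
  then show "T * real_of_int \<lfloor>real k * t / T\<rfloor> / k \<in> {0..T}"
    using 2 assms by (auto simp: pos_divide_le_eq)
qed

lemma discretise_bounded:
  assumes "k > 0" "T > 0" "\<And>t. t \<in> {0..T} \<Longrightarrow> \<bar>x t\<bar> \<le> K" "t \<in> {0..T}"
  shows "\<bar>discretise T k x t\<bar> \<le> K + 1"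
proof -
  have "1 / real k \<le> 1" using assms(1) by simp
  then show ?thesis
    using floor_scaled_dist[OF assms(1), of "x (T * real_of_int \<lfloor>real k * t / T\<rfloor> / k)"]
      assms(3)[OF grid_point_bounds(1)[OF assms(1,2,4)]]
    unfolding discretise_def by linarith
qed

text \<open>
  Let \<open>s\<close> be a grid along which \<open>x\<close> is almost constant, and move each \<open>s i\<close> up to the next sampling
  time \<open>r i\<close>. The sample used at a time of the cell \<open>[r i, r (i + 1))\<close> was taken in that cell, hence in
  \<open>[s i, s (i + 1))\<close>, so that the two paths match along \<open>r\<close> and \<open>s\<close>.
\<close>
lemma discretise_approx:
  assumes x: "cadlag_on T x" and T: "T > 0" and e: "e > 0"
  shows "\<forall>\<^sub>F k in sequentially.
    skorokhod_dist T (discretise T k x) x \<le> e \<and> skorokhod_dist T x (discretise T k x) \<le> e"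
proof -
  obtain s m where s: "grid T s m" and
    osc: "\<And>i u v. i < m \<Longrightarrow> u \<in> {s i..<s (Suc i)} \<Longrightarrow> v \<in> {s i..<s (Suc i)} \<Longrightarrow>
       \<bar>x u - x v\<bar> \<le> e/2 \<and> \<bar>u - v\<bar> \<le> e/2"
    using cadlag_partition[OF x T, of "e/2"] e by auto
  have lim: "\<forall>\<^sub>F k in sequentially. c / real k < d" if "d > 0" for c d :: real
    using order_tendstoD(2)[OF lim_const_over_n[of c] that] by simp
  have "\<forall>\<^sub>F k in sequentially. \<forall>i\<in>{..<m}. T / real k < s (Suc i) - s i"
    by (rule eventually_ball_finite) (use s lim in \<open>auto simp: grid_def\<close>)
  moreover have "\<forall>\<^sub>F k in sequentially. T / real k < e/2" "\<forall>\<^sub>F k in sequentially. 1 / real k < e/2"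
    using e by (auto intro: lim)
  ultimately show ?thesis using eventually_gt_at_top[of 0]
  proof eventually_elim
    case (elim k)
    define r where "r i = T * real_of_int \<lceil>k * s i / T\<rceil> / k" for i
    have k: "real k > 0" using elim by simp
    have gr: "grid T r m"
      unfolding grid_def
    proof (intro conjI allI impI)
      show "r 0 = 0" "r m = T" using s T k by (auto simp: r_def grid_def)
      fix i assume "i < m"
      then have "T / k < s (Suc i) - s i" using elim by auto
      then have "T + k * s i < k * s (Suc i)" using k by (simp add: field_simps)
      then have "(T + k * s i) / T < k * s (Suc i) / T" using T by (rule divide_strict_right_mono)
      then have "k * s i / T + 1 < k * s (Suc i) / T" using T by (simp add: add_divide_distrib)
      then have "\<lceil>k * s i / T\<rceil> < \<lceil>k * s (Suc i) / T\<rceil>" by linarith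
      then have "T * real_of_int \<lceil>k * s i / T\<rceil> < T * real_of_int \<lceil>k * s (Suc i) / T\<rceil>" using T by simp
      then show "r i < r (Suc i)" unfolding r_def using k by (rule divide_strict_right_mono)
    qed
    have cell: "\<bar>discretise T k x u - x v\<bar> \<le> e \<and> \<bar>u - v\<bar> \<le> e"
      if i: "i < m" and u: "u \<in> {r i..<r (Suc i)}" and v: "v \<in> {s i..<s (Suc i)}" for i u v
    proof -
      define j where "j = \<lfloor>k * u / T\<rfloor>"
      define w where "w = T * j / k"
      have "\<lceil>k * s i / T\<rceil> \<le> k * u / T" "k * u / T < \<lceil>k * s (Suc i) / T\<rceil>"
        using u T k by (auto simp: r_def field_simps)
      then have "\<lceil>k * s i / T\<rceil> \<le> j" "j < \<lceil>k * s (Suc i) / T\<rceil>"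
        unfolding j_def by linarith+
      then have "k * s i / T \<le> j" "j < k * s (Suc i) / T" by linarith+
      then have w: "w \<in> {s i..<s (Suc i)}" using T k by (auto simp: w_def field_simps)
      have "j \<le> k * u / T" "k * u / T < j + 1" unfolding j_def by linarith+
      then have "w \<le> u" "u < w + T / k" using T k by (auto simp: w_def field_simps)
      moreover have "\<bar>x w - x v\<bar> \<le> e/2 \<and> \<bar>w - v\<bar> \<le> e/2" by (rule osc[OF i w v])
      moreover have "\<bar>discretise T k x u - x w\<bar> \<le> 1 / k"
        using floor_scaled_dist[of k "x w"] k by (simp add: discretise_def w_def j_def)
      ultimately show ?thesis using elim by linarith
    qed
    have "T * real_of_int \<lfloor>k * T / T\<rfloor> / k = T" using T k by simp
    then have "\<bar>discretise T k x T - x T\<bar> \<le> e"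
      using floor_scaled_dist[of k "x T"] k elim e by (simp add: discretise_def)
    moreover have "\<bar>x v - discretise T k x u\<bar> \<le> e \<and> \<bar>v - u\<bar> \<le> e"
      if "i < m" "v \<in> {s i..<s (Suc i)}" "u \<in> {r i..<r (Suc i)}" for i u v
      using cell[OF that(1,3,2)] by (simp add: abs_minus_commute)
    ultimately show ?case
      using skorokhod_dist_le_of_grids[OF T gr s, of "discretise T k x" x e]
        skorokhod_dist_le_of_grids[OF T s gr, of x "discretise T k x" e] cell
      by (simp add: abs_minus_commute)
  qed
qed

lemma skorokhod_dist_discretise_tendsto:
  assumes x: "cadlag_on T x" and y: "cadlag_on T y" and T: "T > 0"
  shows "(\<lambda>k. skorokhod_dist T (discretise T k x) (discretise T k y)) \<longlonglongrightarrow> skorokhod_dist T x y"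
proof (rule tendstoI)
  fix e :: real assume e: "e > 0"
  obtain K1 where K1: "\<And>t. t \<in> {0..T} \<Longrightarrow> \<bar>x t\<bar> \<le> K1" using cadlag_bounded[OF x T] by blast
  obtain K2 where K2: "\<And>t. t \<in> {0..T} \<Longrightarrow> \<bar>y t\<bar> \<le> K2" using cadlag_bounded[OF y T] by blast
  define K where "K = max K1 K2 + 1"
  have bd: "\<bar>x t\<bar> \<le> K" "\<bar>y t\<bar> \<le> K" if "t \<in> {0..T}" for t
    using K1[OF that] K2[OF that] by (auto simp: K_def)
  have bdk: "\<bar>discretise T k x t\<bar> \<le> K" "\<bar>discretise T k y t\<bar> \<le> K" if "t \<in> {0..T}" "k > 0" for t k
    using discretise_bounded[OF that(2) T _ that(1), of x K1]
      discretise_bounded[OF that(2) T _ that(1), of y K2] K1 K2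
    by (auto simp: K_def)
  have "e/3 > 0" using e by simp
  from discretise_approx[OF x T this] discretise_approx[OF y T this] eventually_gt_at_top[of 0]
  show "\<forall>\<^sub>F k in sequentially.
      dist (skorokhod_dist T (discretise T k x) (discretise T k y)) (skorokhod_dist T x y) < e"
  proof eventually_elim
    case (elim k)
    let ?x = "discretise T k x" and ?y = "discretise T k y"
    have "skorokhod_dist T ?x ?y \<le> skorokhod_dist T ?x x + skorokhod_dist T x ?y"
         "skorokhod_dist T x ?y \<le> skorokhod_dist T x y + skorokhod_dist T y ?y"
         "skorokhod_dist T x y \<le> skorokhod_dist T x ?x + skorokhod_dist T ?x y"
         "skorokhod_dist T ?x y \<le> skorokhod_dist T ?x ?y + skorokhod_dist T ?y y"
      using bd bdk elim by (auto intro!: skorokhod_dist_triangle[OF T, where K = K])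
    then show ?case
      using elim(1)[THEN conjunct1] elim(1)[THEN conjunct2] elim(2)[THEN conjunct1]
        elim(2)[THEN conjunct2] e
      unfolding dist_real_def by linarith
  qed
qed

text \<open>
  Lists over a countable type form a countable type, on which every function is measurable. This
  transfers measurability from finitely many discrete variables to any function of them.
\<close>
lemma measurable_map_upt:
  fixes f :: "nat \<Rightarrow> 'a \<Rightarrow> 'b::countable"
  assumes "\<And>i. i < n \<Longrightarrow> f i \<in> measurable M (count_space UNIV)"
  shows "(\<lambda>\<omega>. map (\<lambda>i. f i \<omega>) [0..<n]) \<in> measurable M (count_space UNIV)"
  using assms
proof (induction n)
  case (Suc n)
  have "(\<lambda>\<omega>. xs @ [f n \<omega>]) \<in> measurable M (count_space UNIV)" for xs
    by (rule measurable_compose[OF Suc.prems[of n]]) auto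
  from measurable_compose_countable[OF this Suc.IH] Suc.prems show ?case by simp
qed simp

text \<open>
  The distance of two discretised paths is a function of two lists of integers that depend
  measurably on \<open>\<omega>\<close>; any function of such lists is measurable, and the distance of the original
  paths is the limit as the discretisation is refined.
\<close>
lemma skorokhod_dist_measurable:
  assumes X: "cadlag_process M T X" and Y: "cadlag_process M T Y" and T: "T > 0"
  shows "(\<lambda>\<omega>. skorokhod_dist T (\<lambda>t. X t \<omega>) (\<lambda>t. Y t \<omega>)) \<in> borel_measurable M"
proof (rule borel_measurable_LIMSEQ_real)
  let ?d = "\<lambda>k \<omega>. skorokhod_dist T (discretise T (Suc k) (\<lambda>t. X t \<omega>)) (discretise T (Suc k) (\<lambda>t. Y t \<omega>))"
  show "(\<lambda>k. ?d k \<omega>) \<longlonglongrightarrow> skorokhod_dist T (\<lambda>t. X t \<omega>) (\<lambda>t. Y t \<omega>)" if "\<omega> \<in> space M" for \<omega>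
    using that X Y skorokhod_dist_discretise_tendsto[OF _ _ T, THEN LIMSEQ_Suc]
    by (auto simp: cadlag_process_def)
  fix k0
  define k where "k = Suc k0"
  have k: "k > 0" by (simp add: k_def)
  define code where "code Z \<omega> = map (\<lambda>i. \<lfloor>k * Z (T * real i / k) \<omega>\<rfloor>) [0..<Suc k]" for Z :: "real \<Rightarrow> 'a \<Rightarrow> real" and \<omega>
  define path where "path v t = real_of_int (v ! nat \<lfloor>k * t / T\<rfloor>) / real k" for v :: "int list" and t :: real
  have code: "code Z \<in> measurable M (count_space UNIV)" if Z: "cadlag_process M T Z" for Z
    unfolding code_def
  proof (rule measurable_map_upt)
    fix i assume "i < Suc k"
    then have "real i * T \<le> real k * T" using T by (intro mult_right_mono) auto
    then have "T * real i / k \<in> {0..T}" using T k by (auto simp: field_simps)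
    then have [measurable]: "Z (T * real i / k) \<in> borel_measurable M"
      using Z by (auto simp: cadlag_process_def)
    show "(\<lambda>\<omega>. \<lfloor>k * Z (T * real i / k) \<omega>\<rfloor>) \<in> measurable M (count_space UNIV)" by measurable
  qed
  have path: "discretise T k (\<lambda>t. Z t \<omega>) t = path (code Z \<omega>) t" if "t \<in> {0..T}" for Z \<omega> t
    using grid_point_bounds[OF k T that] by (simp add: discretise_def path_def code_def less_Suc_eq_le del: upt_Suc)
  have "(\<lambda>\<omega>. skorokhod_dist T (path v) (path (code Y \<omega>))) \<in> borel_measurable M" for v
    by (rule measurable_compose[OF code[OF Y]]) auto
  from measurable_compose_countable[OF this code[OF X]]
  have "(\<lambda>\<omega>. skorokhod_dist T (path (code X \<omega>)) (path (code Y \<omega>))) \<in> borel_measurable M" .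
  moreover have "skorokhod_dist T (path (code X \<omega>)) (path (code Y \<omega>)) = ?d k0 \<omega>" for \<omega>
    unfolding k_def[symmetric] by (rule skorokhod_dist_cong) (simp_all only: path)
  ultimately show "?d k0 \<in> borel_measurable M" by simp
qed

section \<open>Processes at random times\<close>

text \<open>
  By right continuity, \<open>Y\<close> at time \<open>t\<close> is the limit of its values at the first point of the grid of
  mesh \<open>1 / k\<close> after \<open>t\<close>, and those are jointly measurable since such a point takes countably many
  values. Clamping \<open>t\<close> to \<open>{0..T}\<close> keeps the process away from times at which it is unconstrained.
\<close>
lemma cadlag_process_jointly_measurable:
  assumes Y: "cadlag_process M T Y" and T: "T > 0"
  shows "(\<lambda>(t, \<omega>). Y (max 0 (min T t)) \<omega>) \<in> borel_measurable (borel \<Otimes>\<^sub>M M)"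
proof (rule borel_measurable_LIMSEQ_real)
  define c where "c t = max 0 (min T t)" for t
  have c: "c t \<in> {0..T}" for t using T by (auto simp: c_def)
  let ?u = "\<lambda>k t. c ((\<lfloor>real (Suc k) * c t\<rfloor> + 1) / real (Suc k))"
  show "(\<lambda>p. Y (?u k (fst p)) (snd p)) \<in> borel_measurable (borel \<Otimes>\<^sub>M M)" for k
  proof -
    have "(\<lambda>p. Y (c ((i + 1) / real (Suc k))) (snd p)) \<in> borel_measurable (borel \<Otimes>\<^sub>M M)" for i :: int
      using Y c by (intro measurable_compose[OF measurable_snd]) (auto simp: cadlag_process_def)
    moreover have "(\<lambda>p. \<lfloor>real (Suc k) * c (fst p)\<rfloor>) \<in> measurable (borel \<Otimes>\<^sub>M M) (count_space UNIV)"
      unfolding c_def by measurable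
    ultimately show ?thesis by (rule measurable_compose_countable)
  qed
  fix p :: "real \<times> 'a" assume "p \<in> space (borel \<Otimes>\<^sub>M M)"
  then obtain t \<omega> where p: "p = (t, \<omega>)" and \<omega>: "\<omega> \<in> space M" by (auto simp: space_pair_measure)
  define a where "a k = (\<lfloor>real (Suc k) * c t\<rfloor> + 1) / real (Suc k)" for k
  have a: "c t < a k" "a k \<le> c t + 1 / real (Suc k)" for k
  proof -
    have "real (Suc k) * c t < \<lfloor>real (Suc k) * c t\<rfloor> + 1" by linarith
    moreover have "\<lfloor>real (Suc k) * c t\<rfloor> + 1 \<le> real (Suc k) * c t + 1" by linarith
    ultimately show "c t < a k" "a k \<le> c t + 1 / real (Suc k)"
      unfolding a_def by (simp_all add: field_simps del: of_nat_Suc)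
  qed
  have "(\<lambda>k. Y (c (a k)) \<omega>) \<longlonglongrightarrow> Y (c t) \<omega>"
  proof (cases "c t = T")
    case True
    then have "c (a k) = T" for k using a(1)[of k] T by (simp add: c_def)
    then show ?thesis using True by simp
  next
    case False
    then have lt: "c t \<in> {0..<T}" using c[of t] by auto
    have "(\<lambda>k. c t + 1 / real (Suc k)) \<longlonglongrightarrow> c t + 0"
      by (intro tendsto_add tendsto_const LIMSEQ_Suc[OF lim_1_over_n])
    then have "a \<longlonglongrightarrow> c t"
      using a by (intro tendsto_sandwich[of "\<lambda>_. c t" a _ "\<lambda>k. c t + 1 / real (Suc k)"])
        (auto simp: less_imp_le)
    then have "(\<lambda>k. min T (a k)) \<longlonglongrightarrow> min T (c t)" by (intro tendsto_min tendsto_const)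
    moreover have "min T (c t) = c t" "min T (a k) = c (a k)" for k
      using a(1)[of k] lt T by (auto simp: c_def)
    ultimately have "(\<lambda>k. c (a k)) \<longlonglongrightarrow> c t" by simp
    moreover
    have "c t < c (a k)" for k
      using a(1)[of k] lt by (simp add: c_def)
    then have "\<forall>\<^sub>F k in sequentially. c (a k) \<in> {c t<..} \<and> c (a k) \<noteq> c t"
      by (intro always_eventually) (auto simp: less_imp_neq[symmetric])
    ultimately have "filterlim (\<lambda>k. c (a k)) (at_right (c t)) sequentially"
      unfolding filterlim_at by blast
    moreover have "((\<lambda>t. Y t \<omega>) \<longlongrightarrow> Y (c t) \<omega>) (at_right (c t))"
      using Y \<omega> lt by (auto simp: cadlag_process_def cadlag_on_def)
    ultimately show ?thesis by (rule filterlim_compose[rotated])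
  qed
  then show "(\<lambda>k. Y (?u k (fst p)) (snd p)) \<longlonglongrightarrow> (case p of (t, \<omega>) \<Rightarrow> Y (max 0 (min T t)) \<omega>)"
    by (simp add: p a_def c_def)
qed

lemma cadlag_process_at_random_time:
  assumes Y: "cadlag_process M T Y" and T: "T > 0"
    and h: "h \<in> borel_measurable N" and g: "g \<in> measurable N M"
    and h_range: "\<And>p. p \<in> space N \<Longrightarrow> h p \<in> {0..T}"
  shows "(\<lambda>p. Y (h p) (g p)) \<in> borel_measurable N"
proof -
  have "(\<lambda>p. Y (max 0 (min T (h p))) (g p)) \<in> borel_measurable N"
    using measurable_compose[OF measurable_Pair[OF h g] cadlag_process_jointly_measurable[OF Y T]]
    by simp
  also have "?this \<longleftrightarrow> ?thesis"
    by (rule measurable_cong) (use h_range in auto)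
  finally show ?thesis .
qed

section \<open>Averaging over a uniform delay\<close>

lemma measure_uniform_interval_le:
  fixes a b d :: real
  assumes "d > 0" "a \<le> b"
  shows "measure (uniform_measure lborel {0..d}) {a..b} \<le> (b - a) / d"
proof -
  have "measure (uniform_measure lborel {0..d}) {a..b} = measure lborel ({0..d} \<inter> {a..b}) / measure lborel {0..d}"
    using assms by (subst measure_uniform_measure) auto
  also have "\<dots> \<le> measure lborel {a..b} / measure lborel {0..d}"
    by (intro divide_right_mono measure_mono_fmeasurable) (auto simp: fmeasurable_def emeasure_lborel_Icc_eq)
  also have "\<dots> = (b - a) / d" using assms by simp
  finally show ?thesis .
qed

text \<open>
  Negative delays are cut off to make this a time in \<open>{0..T}\<close> for every real \<open>u\<close>; the uniform law
  on \<open>{0..\<delta>}\<close> is a measure on the whole real line.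
\<close>
definition delay :: "real \<Rightarrow> real \<Rightarrow> real \<Rightarrow> real" where
  "delay T a u = min (a + max 0 u) T"

lemma delay_range: "a \<in> {0..T} \<Longrightarrow> delay T a u \<in> {0..T}"
  by (auto simp: delay_def)

text \<open>
  A path \<open>y\<close> at Skorokhod distance less than \<open>\<kappa>\<close> from \<open>x\<close> is uniformly close to \<open>x\<close> at all times
  that are more than \<open>\<kappa>\<close> away from the points of a grid adapted to \<open>x\<close>. The delayed time \<open>a + u\<close>
  comes within \<open>\<kappa>\<close> of a given grid point with probability at most \<open>2 \<kappa> / d\<close>, and truncation at
  \<open>T\<close> does no harm as time changes fix \<open>T\<close>. The bound is uniform in the start time \<open>a\<close>, which
  allows \<open>a\<close> to be replaced by stopping times that vary with \<open>n\<close>.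
\<close>
lemma averaged_reward_modulus:
  fixes \<gamma> :: "real \<times> real \<Rightarrow> real"
  assumes x: "cadlag_on T x" and T: "T > 0" and d: "d > 0" and \<rho>: "\<rho> > 0"
    and cont: "continuous_on ({0..T} \<times> UNIV) \<gamma>"
    and C: "\<And>t z. t \<in> {0..T} \<Longrightarrow> \<bar>\<gamma> (t, z)\<bar> \<le> C"
  obtains \<kappa> where "\<kappa> > 0"
    "\<And>y a. cadlag_on T y \<Longrightarrow> skorokhod_dist T y x < \<kappa> \<Longrightarrow> a \<in> {0..T} \<Longrightarrow>
      (\<integral>u. \<bar>\<gamma> (delay T a u, y (delay T a u)) - \<gamma> (delay T a u, x (delay T a u))\<bar>
         \<partial>uniform_measure lborel {0..d}) \<le> \<rho>"
proof -
  let ?gap = "\<lambda>y a u. \<bar>\<gamma> (delay T a u, y (delay T a u)) - \<gamma> (delay T a u, x (delay T a u))\<bar>"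
  let ?U = "uniform_measure lborel {0..d}"
  obtain K where K: "\<And>t. t \<in> {0..T} \<Longrightarrow> \<bar>x t\<bar> \<le> K" using cadlag_bounded[OF x T] by blast
  have C0: "0 \<le> C" using C[of 0 0] T by auto
  let ?Q = "{0..T} \<times> {-(K + 1)..K + 1}"
  have "uniformly_continuous_on ?Q \<gamma>"
    by (rule compact_uniformly_continuous[OF continuous_on_subset[OF cont]])
      (auto intro: compact_Times)
  then obtain \<eta> where \<eta>: "\<eta> > 0" "\<And>p q. p \<in> ?Q \<Longrightarrow> q \<in> ?Q \<Longrightarrow> dist p q < \<eta> \<Longrightarrow> dist (\<gamma> p) (\<gamma> q) < \<rho> / 2"
    using \<rho> unfolding uniformly_continuous_on_def by (metis half_gt_zero)
  obtain s m where s: "grid T s m" and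
    osc: "\<And>i u v. i < m \<Longrightarrow> u \<in> {s i..<s (Suc i)} \<Longrightarrow> v \<in> {s i..<s (Suc i)} \<Longrightarrow>
       \<bar>x u - x v\<bar> \<le> \<eta>/2 \<and> \<bar>u - v\<bar> \<le> \<eta>/2"
    using cadlag_partition[OF x T, of "\<eta>/2"] \<eta> by auto
  \<comment> \<open>The last term makes \<open>2 C\<close> times the total length of the \<open>m + 1\<close> exceptional intervals, divided by \<open>d\<close>, at most \<open>\<rho> / 2\<close>.\<close>
  define \<kappa> where "\<kappa> = min (min 1 (\<eta> / 2)) (\<rho> * d / (8 * (C + 1) * (m + 1)))"
  have \<kappa>: "\<kappa> > 0" "\<kappa> \<le> 1" "\<kappa> \<le> \<eta> / 2" "\<kappa> \<le> \<rho> * d / (8 * (C + 1) * (m + 1))"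
    using \<eta>(1) \<rho> d C0
    by (auto simp del: divide_const_simps simp: \<kappa>_def min.coboundedI1 min.coboundedI2
        intro!: divide_pos_pos mult_pos_pos)
  have "2 * C * ((m + 1) * (2 * \<kappa> / d)) \<le> 2 * (C + 1) * ((m + 1) * (2 * \<kappa> / d))"
    using \<kappa>(1) d C0 by (intro mult_right_mono) auto
  also have "\<dots> = (\<kappa> * (8 * (C + 1) * (m + 1))) / (2 * d)"
    using d by (simp add: field_simps)
  also have "\<dots> \<le> (\<rho> * d) / (2 * d)"
    using \<kappa>(4) d C0 by (intro divide_right_mono) (auto simp: pos_le_divide_eq)
  also have "\<dots> = \<rho> / 2" using d by simp
  finally have small: "2 * C * ((m + 1) * (2 * \<kappa> / d)) \<le> \<rho> / 2" .
  have main: "(\<integral>u. ?gap y a u \<partial>?U) \<le> \<rho>" if y: "cadlag_on T y" and dyx: "skorokhod_dist T y x < \<kappa>" and a: "a \<in> {0..T}" for y a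
  proof -
    obtain K2 where K2: "\<And>t. t \<in> {0..T} \<Longrightarrow> \<bar>y t\<bar> \<le> K2" using cadlag_bounded[OF y T] by blast
    obtain l where l: "l \<in> time_changes T"
      "\<And>t. t \<in> {0..T} \<Longrightarrow> \<bar>l t - t\<bar> < \<kappa> \<and> \<bar>y t - x (l t)\<bar> < \<kappa>"
      using skorokhod_dist_lessD[of T y "max K K2" x \<kappa>] T K K2 dyx by (metis max.coboundedI1 max.coboundedI2)
    have close: "\<bar>\<gamma> (t, y t) - \<gamma> (t, x t)\<bar> \<le> \<rho> / 2" if t: "t \<in> {0..T}" and "\<bar>x (l t) - x t\<bar> \<le> \<eta> / 2" for t
    proof -
      have "\<bar>y t\<bar> \<le> K + 1"
        using l(2)[OF t] K[OF time_change_mem[OF l(1) t]] \<kappa>(2) by linarith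
      moreover have "\<bar>y t - x t\<bar> < \<eta>" using l(2)[OF t] that(2) \<kappa>(3) by linarith
      ultimately show ?thesis
        using \<eta>(2)[of "(t, y t)" "(t, x t)"] K[OF t] t by (simp add: dist_Pair_Pair dist_real_def abs_le_iff)
    qed
    have close_T: "\<bar>\<gamma> (T, y T) - \<gamma> (T, x T)\<bar> \<le> \<rho> / 2"
      using close[of T] time_change_end[OF l(1) T] T \<eta> by simp
    \<comment> \<open>The exceptional delays, for which \<open>a + u\<close> is within \<open>\<kappa>\<close> of a grid point.\<close>
    let ?I = "\<lambda>i. {s i - \<kappa> - a..s i + \<kappa> - a}"
    let ?b = "\<lambda>u. \<rho> / 2 + 2 * C * (\<Sum>i\<le>m. indicator (?I i) u)"
    have sum0: "0 \<le> (\<Sum>i\<le>m. indicator (?I i) u :: real)" for u by (intro sum_nonneg) auto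
    interpret U: prob_space ?U by (rule prob_space_uniform_measure) (use d in auto)
    have U1: "U.prob UNIV = 1" using U.prob_space by (simp add: space_uniform_measure)
    have int: "integrable ?U ?b"
      by (intro Bochner_Integration.integrable_add integrable_mult_right
          Bochner_Integration.integrable_sum U.integrable_const U.integrable_const_bound[where B = 1]) auto
    have pointwise: "?gap y a u \<le> ?b u"
      if "0 \<le> u" for u
    proof (cases "a + u < T")
      case False
      then have "delay T a u = T" using that by (simp add: delay_def)
      then have "?gap y a u \<le> \<rho> / 2"
        using close_T by simp
      moreover have "0 \<le> 2 * C * (\<Sum>i\<le>m. indicator (?I i) u)"
        using sum0[of u] C0 by (intro mult_nonneg_nonneg) auto
      ultimately show ?thesis by linarith
    next
      case True
      let ?t = "a + u"
      have t: "?t \<in> {0..T}" "delay T a u = ?t" using True that a by (auto simp: delay_def)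
      have "\<bar>\<gamma> (?t, y ?t) - \<gamma> (?t, x ?t)\<bar> \<le> ?b u"
      proof (cases "\<exists>i\<le>m. u \<in> ?I i")
        case True
        then obtain i where i: "i \<le> m" "u \<in> ?I i" by auto
        have "indicator (?I i) u \<le> (\<Sum>i\<le>m. indicator (?I i) u :: real)"
          using i by (intro member_le_sum) auto
        then have "1 \<le> (\<Sum>i\<le>m. indicator (?I i) u :: real)" using i by simp
        then have "2 * C * 1 \<le> 2 * C * (\<Sum>i\<le>m. indicator (?I i) u)"
          using C0 by (intro mult_left_mono) auto
        then show ?thesis using C[OF t(1), of "y ?t"] C[OF t(1), of "x ?t"] \<rho> by linarith
      next
        case far: False
        obtain i where i: "i < m" "s i \<le> ?t" "?t < s (Suc i)"
          using grid_cell[OF s, of ?t] t True by auto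
        \<comment> \<open>Far from both ends of its cell, a time is kept in the same cell by a time change that moves it by less than \<open>\<kappa>\<close>.\<close>
        have "u \<notin> ?I i" "u \<notin> ?I (Suc i)" using far i by auto
        then have "l ?t \<in> {s i..<s (Suc i)}"
          using i l(2)[OF t(1)] by auto
        then have "\<bar>x (l ?t) - x ?t\<bar> \<le> \<eta> / 2" using osc[OF i(1), of "l ?t" ?t] i by auto
        then have "\<bar>\<gamma> (?t, y ?t) - \<gamma> (?t, x ?t)\<bar> \<le> \<rho> / 2" by (rule close[OF t(1)])
        moreover have "0 \<le> 2 * C * (\<Sum>i\<le>m. indicator (?I i) u)"
          using sum0[of u] C0 by (intro mult_nonneg_nonneg) auto
        ultimately show ?thesis by linarith
      qed
      then show ?thesis using t by simp
    qed
    have "(\<integral>u. ?gap y a u \<partial>?U) \<le> (\<integral>u. ?b u \<partial>?U)"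
    proof (rule integral_mono_AE')
      show "integrable ?U ?b" by (rule int)
      have "AE u in ?U. u \<in> {0..d}"
        by (rule AE_uniform_measureI) auto
      then show "AE u in ?U. ?gap y a u \<le> ?b u"
        by (rule AE_mp) (use pointwise in auto)
    qed (use sum0 C0 \<rho> in \<open>auto intro!: add_nonneg_nonneg mult_nonneg_nonneg AE_I2\<close>)
    also have "(\<integral>u. ?b u \<partial>?U) = \<rho> / 2 + 2 * C * (\<Sum>i\<le>m. measure ?U (?I i))"
      by (subst Bochner_Integration.integral_add)
        (auto intro!: Bochner_Integration.integrable_sum U.integrable_const_bound[where B = 1]
          simp: Bochner_Integration.integral_sum U.emeasure_eq_measure U1)
    also have "(\<Sum>i\<le>m. measure ?U (?I i)) \<le> (\<Sum>i\<le>m. 2 * \<kappa> / d)"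
      using \<kappa>(1) by (intro sum_mono order.trans[OF measure_uniform_interval_le[OF d]]) auto
    also have "(\<Sum>i\<le>m. 2 * \<kappa> / d) = (m + 1) * (2 * \<kappa> / d)" by simp
    finally show ?thesis using small C0 by (simp add: mult_left_mono)
  qed
  show ?thesis using that[OF \<kappa>(1) main] by blast
qed

section \<open>Convergence in probability and tightness\<close>

lemma (in prob_space) expectation_affine_indicators:
  assumes "finite I" "\<And>i. i \<in> I \<Longrightarrow> A i \<in> events"
  shows "integrable M (\<lambda>\<omega>. a + c * (\<Sum>i\<in>I. indicator (A i) \<omega>) :: real)"
    and "expectation (\<lambda>\<omega>. a + c * (\<Sum>i\<in>I. indicator (A i) \<omega>)) = a + c * (\<Sum>i\<in>I. prob (A i))"
proof -
  have "integrable M (indicator (A i) :: 'a \<Rightarrow> real)" if "i \<in> I" for i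
    by (rule integrable_const_bound[of _ 1]) (use assms(2)[OF that] in auto)
  then have sum: "integrable M (\<lambda>\<omega>. \<Sum>i\<in>I. indicator (A i) \<omega> :: real)"
    and "expectation (\<lambda>\<omega>. \<Sum>i\<in>I. indicator (A i) \<omega>) = (\<Sum>i\<in>I. prob (A i))"
    using assms(2) by (auto intro!: sum.cong simp: Bochner_Integration.integral_sum)
  then show "integrable M (\<lambda>\<omega>. a + c * (\<Sum>i\<in>I. indicator (A i) \<omega>) :: real)"
    "expectation (\<lambda>\<omega>. a + c * (\<Sum>i\<in>I. indicator (A i) \<omega>)) = a + c * (\<Sum>i\<in>I. prob (A i))"
    by (auto simp: prob_space)
qed

text \<open>
  The threshold \<open>\<kappa>\<close> may depend on \<open>\<omega>\<close> in a non-measurable way. But the event that the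
  threshold \<open>1 / (k + 1)\<close> works for all \<open>n\<close> is a countable intersection, and these events
  increase to the whole space. Off a small set, one threshold therefore serves all \<open>\<omega>\<close>.
\<close>
lemma (in prob_space) expectation_tendsto_0_of_pathwise_modulus:
  fixes d L :: "nat \<Rightarrow> 'a \<Rightarrow> real"
  assumes [measurable]: "\<And>n. d n \<in> borel_measurable M" "\<And>n. L n \<in> borel_measurable M"
    and L: "\<And>n \<omega>. \<omega> \<in> space M \<Longrightarrow> 0 \<le> L n \<omega> \<and> L n \<omega> \<le> C"
    and conv: "\<And>e. e > 0 \<Longrightarrow> (\<lambda>n. prob {\<omega>\<in>space M. e \<le> d n \<omega>}) \<longlonglongrightarrow> 0"
    and modulus: "\<And>\<omega> \<rho>. \<omega> \<in> space M \<Longrightarrow> \<rho> > 0 \<Longrightarrow> \<exists>\<kappa>>0. \<forall>n. d n \<omega> < \<kappa> \<longrightarrow> L n \<omega> \<le> \<rho>"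
  shows "(\<lambda>n. expectation (L n)) \<longlonglongrightarrow> 0"
proof (rule tendstoI)
  fix e :: real assume e: "e > 0"
  obtain \<omega>0 where "\<omega>0 \<in> space M" using not_empty by blast
  then have C: "0 \<le> C" using L[of \<omega>0 0] by linarith
  define \<eta> where "\<eta> = e / (3 * (C + 1))"
  have \<eta>: "\<eta> > 0" using e C by (simp add: \<eta>_def)
  have "C * \<eta> \<le> (C + 1) * \<eta>" using \<eta> by (intro mult_right_mono) auto
  also have "(C + 1) * \<eta> = e / 3" using C by (simp add: \<eta>_def field_simps)
  finally have C\<eta>: "C * \<eta> \<le> e / 3" .
  define G where "G k = {\<omega>\<in>space M. \<forall>n. d n \<omega> < 1 / real (Suc k) \<longrightarrow> L n \<omega> \<le> e / 4}" for k
  have G[measurable]: "G k \<in> sets M" for k unfolding G_def by measurable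
  have "incseq G"
  proof (rule incseq_SucI)
    have le: "1 / real (Suc (Suc k)) \<le> 1 / real (Suc k)" for k by (simp add: frac_le)
    show "G k \<subseteq> G (Suc k)" for k
      unfolding G_def using order.strict_trans2[OF _ le[of k]] by blast
  qed
  moreover have "(\<Union>k. G k) = space M"
  proof
    show "space M \<subseteq> (\<Union>k. G k)"
    proof
      fix \<omega> assume \<omega>: "\<omega> \<in> space M"
      have "e / 4 > 0" using e by simp
      from modulus[OF \<omega> this] obtain \<kappa> where \<kappa>: "\<kappa> > 0" "\<forall>n. d n \<omega> < \<kappa> \<longrightarrow> L n \<omega> \<le> e / 4" by blast
      obtain k where k: "1 / real (Suc k) < \<kappa>" using nat_approx_posE[OF \<kappa>(1)] by blast
      have "L n \<omega> \<le> e / 4" if "d n \<omega> < 1 / real (Suc k)" for n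
        using \<kappa>(2) order.strict_trans[OF that k] by simp
      then show "\<omega> \<in> (\<Union>k. G k)" using \<omega> unfolding G_def by blast
    qed
  qed (auto simp: G_def)
  ultimately have "(\<lambda>k. prob (G k)) \<longlonglongrightarrow> 1"
    using finite_Lim_measure_incseq[of G] prob_space by (auto simp: image_subset_iff)
  from order_tendstoD(1)[OF this, of "1 - \<eta>"] \<eta> obtain k where k: "prob (G k) > 1 - \<eta>"
    by (auto dest: eventually_happens)
  let ?B = "space M - G k" and ?D = "\<lambda>n. {\<omega>\<in>space M. 1 / real (Suc k) \<le> d n \<omega>}"
  have B: "prob ?B < \<eta>" using k prob_compl[OF G[of k]] by linarith
  have "\<forall>\<^sub>F n in sequentially. prob (?D n) < \<eta>"
    by (rule order_tendstoD(2)[OF conv \<eta>]) simp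
  then show "\<forall>\<^sub>F n in sequentially. dist (expectation (L n)) 0 < e"
  proof eventually_elim
    case (elim n)
    let ?E = "\<lambda>i::nat. if i = 0 then ?B else ?D n"
    let ?b = "\<lambda>\<omega>. e / 4 + C * (\<Sum>i\<in>{0, 1}. indicator (?E i) \<omega>)"
    have "?D n \<in> sets M" by measurable
    then have E: "?E i \<in> sets M" for i by simp
    have int: "integrable M (L n)" by (rule integrable_const_bound[of _ C]) (use L in auto)
    have "expectation (L n) \<le> expectation ?b"
    proof (rule integral_mono[OF int])
      show "integrable M ?b" by (intro expectation_affine_indicators E) simp
      fix \<omega> assume \<omega>: "\<omega> \<in> space M"
      show "L n \<omega> \<le> ?b \<omega>"
        using L[OF \<omega>, of n] \<omega> C e by (auto simp: G_def split: split_indicator)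
    qed
    also have "expectation ?b = e / 4 + C * (\<Sum>i\<in>{0, 1}. prob (?E i))"
      by (intro expectation_affine_indicators E) simp
    also have "\<dots> \<le> e / 4 + C * (\<eta> + \<eta>)"
      using C B elim by (intro add_mono mult_left_mono) auto
    also have "\<dots> < e" using C\<eta> e by (simp add: algebra_simps)
    finally have "expectation (L n) < e" .
    moreover have "0 \<le> expectation (L n)" by (rule integral_nonneg_AE) (use L in auto)
    ultimately show ?case by simp
  qed
qed

lemma (in prob_space) cadlag_process_tight:
  assumes X: "cadlag_process M T X" and T: "T > 0" and p: "p > 0"
  obtains K where "{\<omega>\<in>space M. \<forall>t\<in>{0..T}. \<bar>X t \<omega>\<bar> \<le> K} \<in> sets M"
    "prob {\<omega>\<in>space M. \<exists>t\<in>{0..T}. \<bar>X t \<omega>\<bar> > K} < p"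
proof -
  let ?Q = "insert T (\<rat> \<inter> {0..T})"
  define A where "A k = {\<omega>\<in>space M. \<forall>t\<in>{0..T}. \<bar>X t \<omega>\<bar> \<le> real k}" for k :: nat
  have A_eq: "A k = {\<omega>\<in>space M. \<forall>q\<in>?Q. \<bar>X q \<omega>\<bar> \<le> real k}" for k
  proof -
    have "(\<forall>t\<in>{0..T}. \<bar>X t \<omega>\<bar> \<le> real k) \<longleftrightarrow> (\<forall>q\<in>?Q. \<bar>X q \<omega>\<bar> \<le> real k)" if "\<omega> \<in> space M" for \<omega>
    proof
      assume *: "\<forall>q\<in>?Q. \<bar>X q \<omega>\<bar> \<le> real k"
      have "cadlag_on T (\<lambda>t. X t \<omega>)" using X that by (simp add: cadlag_process_def)
      from cadlag_bound_from_rationals[OF this T, of "real k"] *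
      show "\<forall>t\<in>{0..T}. \<bar>X t \<omega>\<bar> \<le> real k" by blast
    qed (use T in auto)
    then show ?thesis unfolding A_def by blast
  qed
  have "countable ?Q" using countable_rat by auto
  moreover have "{\<omega>\<in>space M. \<bar>X q \<omega>\<bar> \<le> real k} \<in> sets M" if "q \<in> ?Q" for q k
  proof -
    have [measurable]: "X q \<in> borel_measurable M" using X T that by (auto simp: cadlag_process_def)
    show ?thesis by measurable
  qed
  ultimately have "(\<Inter>q\<in>?Q. {\<omega>\<in>space M. \<bar>X q \<omega>\<bar> \<le> real k}) \<in> sets M" for k
    by (intro sets.countable_INT') auto
  also have "(\<Inter>q\<in>?Q. {\<omega>\<in>space M. \<bar>X q \<omega>\<bar> \<le> real k}) = A k" for k
    unfolding A_eq by blast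
  finally have A[measurable]: "A k \<in> sets M" for k .
  have "incseq A" by (rule incseq_SucI) (fastforce simp: A_def)
  moreover have "(\<Union>k. A k) = space M"
  proof
    show "space M \<subseteq> (\<Union>k. A k)"
    proof
      fix \<omega> assume \<omega>: "\<omega> \<in> space M"
      then obtain K where K: "\<And>t. t \<in> {0..T} \<Longrightarrow> \<bar>X t \<omega>\<bar> \<le> K"
        using cadlag_bounded[OF _ T] X unfolding cadlag_process_def by metis
      obtain k :: nat where "K \<le> real k" using real_arch_simple by blast
      then have "\<bar>X t \<omega>\<bar> \<le> real k" if "t \<in> {0..T}" for t
        using K[OF that] by linarith
      then show "\<omega> \<in> (\<Union>k. A k)" using \<omega> unfolding A_def by blast
    qed
  qed (auto simp: A_def)
  ultimately have "(\<lambda>k. prob (A k)) \<longlonglongrightarrow> 1"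
    using finite_Lim_measure_incseq[of A] prob_space by (auto simp: image_subset_iff)
  from order_tendstoD(1)[OF this, of "1 - p"] p obtain k where k: "prob (A k) > 1 - p"
    by (auto dest: eventually_happens)
  have "{\<omega>\<in>space M. \<exists>t\<in>{0..T}. \<bar>X t \<omega>\<bar> > real k} = space M - A k" by (auto simp: A_def not_le)
  then show ?thesis
    using that[of "real k"] A[of k] k prob_compl[OF A[of k]] by (simp add: A_def)
qed

section \<open>Stopping times and rewards at random times\<close>

lemma space_natural_filtration: "space (natural_filtration M Y t) = space M"
  unfolding natural_filtration_def by (rule space_measure_of) auto

lemma sets_natural_filtration_mono:
  assumes "s \<le> t"
  shows "sets (natural_filtration M Y s) \<subseteq> sets (natural_filtration M Y t)"
  unfolding natural_filtration_def
  using assms by (subst (1 2) sets_measure_of) (force intro!: sigma_sets_mono')+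

lemma sets_natural_filtration_subset:
  assumes "cadlag_process M T Y" "t \<le> T"
  shows "sets (natural_filtration M Y t) \<subseteq> sets M"
  unfolding natural_filtration_def
  by (subst sets_measure_of)
    (use assms in \<open>auto intro!: sets.sigma_sets_subset simp: cadlag_process_def intro: measurable_sets\<close>)

lemma space_right_cont_filtration: "space (right_cont_filtration M T X t) = space M"
proof (cases "t < T")
  case True
  have "(\<Inter>s\<in>{t<..T}. sets (natural_filtration M X s)) \<subseteq> sets (natural_filtration M X T)"
    using True by auto
  also have "\<dots> \<subseteq> Pow (space M)" using sets.space_closed space_natural_filtration by metis
  finally show ?thesis
    unfolding right_cont_filtration_def by (simp only: True if_True space_measure_of)
qed (simp add: right_cont_filtration_def space_natural_filtration)

text \<open>
  At times outside \<open>{0..<T}\<close> the event \<open>\<tau> \<le> t\<close> is empty or the whole space.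
\<close>
lemma stopping_times_upto_iff:
  assumes sp: "\<And>t. space (F t) = space M"
  shows "\<tau> \<in> stopping_times_upto M T F \<longleftrightarrow>
    (\<forall>\<omega>\<in>space M. \<tau> \<omega> \<in> {0..T}) \<and> (\<forall>t\<in>{0..<T}. {\<omega>\<in>space M. \<tau> \<omega> \<le> t} \<in> sets (F t))"
proof -
  have "{\<omega>\<in>space M. \<tau> \<omega> \<le> t} \<in> sets (F t)"
    if range: "\<forall>\<omega>\<in>space M. \<tau> \<omega> \<in> {0..T}" and "t \<notin> {0..<T}" for t
  proof (cases "t < 0")
    case True
    then have "{\<omega>\<in>space M. \<tau> \<omega> \<le> t} = {}" using range by fastforce
    then show ?thesis by (simp only: sets.empty_sets)
  next
    case False
    then have "{\<omega>\<in>space M. \<tau> \<omega> \<le> t} = space (F t)" using range that(2) sp by fastforce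
    then show ?thesis by (simp only: sets.top)
  qed
  then show ?thesis
    unfolding stopping_times_upto_def stopping_time_def pred_def sp by blast
qed

lemma stopping_times_upto_mono:
  assumes "\<And>t. space (F t) = space M" "\<And>t. space (G t) = space M"
    and "\<And>t. t \<in> {0..T} \<Longrightarrow> sets (F t) \<subseteq> sets (G t)"
  shows "stopping_times_upto M T F \<subseteq> stopping_times_upto M T G"
  using assms(3) by (auto simp: stopping_times_upto_iff[OF assms(1)] stopping_times_upto_iff[OF assms(2)] subset_iff)

text \<open>
  Before \<open>T\<close>, the event \<open>min (\<tau> + u) T \<le> t\<close> is \<open>\<tau> \<le> t - u\<close>, known already at time \<open>t - u\<close>.
\<close>
lemma delayed_stopping_time:
  assumes "\<tau> \<in> stopping_times_upto M T (natural_filtration M Y)"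
  shows "(\<lambda>\<omega>. delay T (\<tau> \<omega>) u) \<in> stopping_times_upto M T (natural_filtration M Y)"
proof -
  note iff = stopping_times_upto_iff[OF space_natural_filtration]
  have range: "\<tau> \<omega> \<in> {0..T}" if "\<omega> \<in> space M" for \<omega> using assms that by (simp add: iff)
  have adapted: "{\<omega>\<in>space M. \<tau> \<omega> \<le> s} \<in> sets (natural_filtration M Y s)" if "s \<in> {0..<T}" for s
    using assms that unfolding iff by blast
  have "{\<omega>\<in>space M. delay T (\<tau> \<omega>) u \<le> t} \<in> sets (natural_filtration M Y t)" if t: "t \<in> {0..<T}" for t
  proof -
    have eq: "{\<omega>\<in>space M. delay T (\<tau> \<omega>) u \<le> t} = {\<omega>\<in>space M. \<tau> \<omega> \<le> t - max 0 u}"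
      using t by (auto simp: delay_def)
    show ?thesis
    proof (cases "t - max 0 u < 0")
      case True
      then have "{\<omega>\<in>space M. \<tau> \<omega> \<le> t - max 0 u} = {}" using range by fastforce
      then show ?thesis by (simp only: eq sets.empty_sets)
    next
      case False
      then have "{\<omega>\<in>space M. \<tau> \<omega> \<le> t - max 0 u} \<in> sets (natural_filtration M Y (t - max 0 u))"
        using t by (intro adapted) auto
      then show ?thesis
        using sets_natural_filtration_mono[of "t - max 0 u" t M Y] by (auto simp: eq)
    qed
  qed
  then show ?thesis using range delay_range by (auto simp: iff)
qed

lemma stopping_times_upto_measurable:
  assumes \<tau>: "\<tau> \<in> stopping_times_upto M T (natural_filtration M Y)" and Y: "cadlag_process M T Y"
  shows "\<tau> \<in> borel_measurable M"
proof (rule borel_measurableI_le)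
  note iff = stopping_times_upto_iff[OF space_natural_filtration]
  have range: "0 \<le> \<tau> \<omega> \<and> \<tau> \<omega> \<le> T" if "\<omega> \<in> space M" for \<omega> using \<tau> that by (simp add: iff)
  fix t
  consider "t < 0" | "t \<in> {0..<T}" | "T \<le> t" by fastforce
  then show "{\<omega>\<in>space M. \<tau> \<omega> \<le> t} \<in> sets M"
  proof cases
    case 1
    then have "{\<omega>\<in>space M. \<tau> \<omega> \<le> t} = {}" using range by fastforce
    then show ?thesis by (simp only: sets.empty_sets)
  next
    case 2
    then show ?thesis using \<tau> sets_natural_filtration_subset[OF Y, of t] by (auto simp: iff)
  next
    case 3
    then have "{\<omega>\<in>space M. \<tau> \<omega> \<le> t} = space M" using range by fastforce
    then show ?thesis by (simp only: sets.top)
  qed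
qed

lemma reward_at_random_time_measurable:
  fixes \<gamma> :: "real \<times> real \<Rightarrow> real"
  assumes Y: "cadlag_process M T Y" and T: "T > 0"
    and cont: "continuous_on ({0..T} \<times> UNIV) \<gamma>"
    and h: "h \<in> borel_measurable N" and g: "g \<in> measurable N M"
    and h_range: "\<And>p. p \<in> space N \<Longrightarrow> h p \<in> {0..T}"
  shows "(\<lambda>p. \<gamma> (h p, Y (h p) (g p))) \<in> borel_measurable N"
proof -
  have "continuous_on UNIV (\<lambda>q. \<gamma> (max 0 (min T (fst q)), snd q))"
    by (rule continuous_on_compose2[OF cont]) (use T in \<open>auto intro!: continuous_intros\<close>)
  then have "(\<lambda>q. \<gamma> (max 0 (min T (fst q)), snd q)) \<in> borel_measurable (borel \<Otimes>\<^sub>M borel)"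
    by (simp add: borel_prod borel_measurable_continuous_onI)
  from measurable_compose[OF measurable_Pair[OF h cadlag_process_at_random_time[OF Y T h g h_range]] this]
  have "(\<lambda>p. \<gamma> (max 0 (min T (h p)), Y (h p) (g p))) \<in> borel_measurable N" by simp
  also have "?this \<longleftrightarrow> ?thesis" by (rule measurable_cong) (use h_range in auto)
  finally show ?thesis .
qed

section \<open>Aldous' criterion for rewards\<close>

lemma dist_Pair_le: "dist (a::real, b::real) (c, d) \<le> \<bar>a - c\<bar> + \<bar>b - d\<bar>"
  unfolding dist_Pair_Pair dist_real_def
  using sqrt_sum_squares_le_sum_abs[of "\<bar>a - c\<bar>" "\<bar>b - d\<bar>"] by simp

text \<open>
  Off three rare events -- \<open>\<bar>X\<bar>\<close> exceeds \<open>K\<close>, the Skorokhod distance from \<open>X\<^sup>n\<close> to \<open>X\<close> is at least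
  \<open>1\<close>, the increment of \<open>X\<^sup>n\<close> between \<open>\<sigma>\<close> and \<open>\<nu>\<close> is large -- both points \<open>(\<sigma>, X\<^sup>n\<^sub>\<sigma>)\<close> and
  \<open>(\<nu>, X\<^sup>n\<^sub>\<nu>)\<close> lie in the compact set \<open>{0..T} \<times> {-(K + 1)..K + 1}\<close>, where \<open>\<gamma>\<close> is uniformly continuous,
  and they are close to each other. Aldous' criterion makes the third event rare.
\<close>
lemma (in prob_space) aldous_reward_insensitive_to_delay:
  fixes \<gamma> :: "real \<times> real \<Rightarrow> real"
  assumes T: "T > 0" and X: "cadlag_process M T X" and Xn: "\<And>n. cadlag_process M T (Xn n)"
    and cont: "continuous_on ({0..T} \<times> UNIV) \<gamma>"
    and C: "\<And>t z. t \<in> {0..T} \<Longrightarrow> \<bar>\<gamma> (t, z)\<bar> \<le> C"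
    and conv: "skorokhod_tendsto_in_prob M T Xn X"
    and aldous: "aldous_criterion M T Xn" and e: "e > 0"
  obtains \<delta> where "\<delta> > 0"
    "\<forall>\<^sub>F n in sequentially. \<forall>\<sigma>\<in>stopping_times_upto M T (natural_filtration M (Xn n)).
       \<forall>\<nu>\<in>stopping_times_upto M T (natural_filtration M (Xn n)).
       (\<forall>\<omega>\<in>space M. \<sigma> \<omega> \<le> \<nu> \<omega> \<and> \<nu> \<omega> \<le> \<sigma> \<omega> + \<delta>) \<longrightarrow>
       (\<integral>\<omega>. \<gamma> (\<sigma> \<omega>, Xn n (\<sigma> \<omega>) \<omega>) \<partial>M) \<le> (\<integral>\<omega>. \<gamma> (\<nu> \<omega>, Xn n (\<nu> \<omega>) \<omega>) \<partial>M) + e"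
proof -
  let ?S = "\<lambda>n. stopping_times_upto M T (natural_filtration M (Xn n))"
  have C0: "0 \<le> C" using C[of 0 0] T by auto
  define p where "p = e / (12 * (C + 1))"
  have p: "p > 0" using e C0 by (simp add: p_def)
  have "C * p \<le> (C + 1) * p" using p by (intro mult_right_mono) auto
  also have "(C + 1) * p = e / 12" using C0 by (simp add: p_def field_simps)
  finally have Cp: "C * p \<le> e / 12" .
  obtain K where K_meas: "{\<omega>\<in>space M. \<forall>t\<in>{0..T}. \<bar>X t \<omega>\<bar> \<le> K} \<in> sets M"
    and K: "prob {\<omega>\<in>space M. \<exists>t\<in>{0..T}. \<bar>X t \<omega>\<bar> > K} < p"
    using cadlag_process_tight[OF X T p] by blast
  define A where "A = {\<omega>\<in>space M. \<exists>t\<in>{0..T}. \<bar>X t \<omega>\<bar> > K}"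
  have "A = space M - {\<omega>\<in>space M. \<forall>t\<in>{0..T}. \<bar>X t \<omega>\<bar> \<le> K}" by (auto simp: A_def not_le)
  then have A[measurable]: "A \<in> sets M" using K_meas by simp
  let ?Q = "{0..T} \<times> {-(K + 1)..K + 1}"
  have "uniformly_continuous_on ?Q \<gamma>"
    by (rule compact_uniformly_continuous[OF continuous_on_subset[OF cont]])
      (auto intro: compact_Times)
  then obtain \<eta> where \<eta>: "\<eta> > 0" "\<And>p q. p \<in> ?Q \<Longrightarrow> q \<in> ?Q \<Longrightarrow> dist p q < \<eta> \<Longrightarrow> dist (\<gamma> p) (\<gamma> q) < e / 2"
    using e unfolding uniformly_continuous_on_def by (metis half_gt_zero)
  define osc where "osc n \<sigma> \<nu> = {\<omega>\<in>space M. \<eta> / 2 \<le> \<bar>Xn n (\<sigma> \<omega>) \<omega> - Xn n (\<nu> \<omega>) \<omega>\<bar>}" for n \<sigma> \<nu>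
  define W where "W = (\<lambda>\<delta> n. SUP (\<sigma>, \<nu>) \<in> {(\<sigma>, \<nu>). \<sigma> \<in> ?S n \<and> \<nu> \<in> ?S n \<and>
            (\<forall>\<omega>\<in>space M. \<sigma> \<omega> \<le> \<nu> \<omega> \<and> \<nu> \<omega> \<le> \<sigma> \<omega> + \<delta>)}. ereal (prob (osc n \<sigma> \<nu>)))"
  have "\<eta> / 2 > 0" using \<eta>(1) by simp
  from aldous[unfolded aldous_criterion_def, rule_format, OF this]
  have "((\<lambda>\<delta>. limsup (W \<delta>)) \<longlongrightarrow> 0) (at_right 0)"
    unfolding W_def osc_def .
  then have "\<forall>\<^sub>F \<delta> in at_right 0. limsup (W \<delta>) < ereal p"
    by (rule order_tendstoD) (use p in simp)
  then obtain b where b: "b > 0" "\<And>\<delta>. 0 < \<delta> \<Longrightarrow> \<delta> < b \<Longrightarrow> limsup (W \<delta>) < ereal p"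
    by (auto simp: eventually_at_right_field)
  define \<delta> where "\<delta> = min (b / 2) (\<eta> / 2)"
  have \<delta>: "\<delta> > 0" "\<delta> < b" "\<delta> \<le> \<eta> / 2" using b \<eta> by (auto simp: \<delta>_def)
  let ?D = "\<lambda>n. {\<omega>\<in>space M. 1 \<le> skorokhod_dist T (\<lambda>t. Xn n t \<omega>) (\<lambda>t. X t \<omega>)}"
  have "\<forall>\<^sub>F n in sequentially. W \<delta> n < ereal p"
    by (rule Limsup_lessD) (rule b(2)[OF \<delta>(1,2)])
  moreover have "\<forall>\<^sub>F n in sequentially. prob (?D n) < p"
    using conv p by (intro order_tendstoD(2)[of _ 0]) (auto simp: skorokhod_tendsto_in_prob_def)
  ultimately have "\<forall>\<^sub>F n in sequentially. \<forall>\<sigma>\<in>?S n. \<forall>\<nu>\<in>?S n.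
       (\<forall>\<omega>\<in>space M. \<sigma> \<omega> \<le> \<nu> \<omega> \<and> \<nu> \<omega> \<le> \<sigma> \<omega> + \<delta>) \<longrightarrow>
       (\<integral>\<omega>. \<gamma> (\<sigma> \<omega>, Xn n (\<sigma> \<omega>) \<omega>) \<partial>M) \<le> (\<integral>\<omega>. \<gamma> (\<nu> \<omega>, Xn n (\<nu> \<omega>) \<omega>) \<partial>M) + e"
  proof eventually_elim
    case (elim n)
    have D[measurable]: "?D n \<in> sets M"
      using skorokhod_dist_measurable[OF Xn X T, of n] by measurable
    show ?case
    proof (intro ballI impI)
      fix \<sigma> \<nu> assume \<sigma>: "\<sigma> \<in> ?S n" and \<nu>: "\<nu> \<in> ?S n"
        and le: "\<forall>\<omega>\<in>space M. \<sigma> \<omega> \<le> \<nu> \<omega> \<and> \<nu> \<omega> \<le> \<sigma> \<omega> + \<delta>"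
      have range: "\<sigma> \<omega> \<in> {0..T}" "\<nu> \<omega> \<in> {0..T}" if "\<omega> \<in> space M" for \<omega>
        using \<sigma> \<nu> that by (auto simp: stopping_times_upto_def)
      note meas = stopping_times_upto_measurable[OF \<sigma> Xn] stopping_times_upto_measurable[OF \<nu> Xn]
      have [measurable]: "(\<lambda>\<omega>. Xn n (\<sigma> \<omega>) \<omega>) \<in> borel_measurable M" "(\<lambda>\<omega>. Xn n (\<nu> \<omega>) \<omega>) \<in> borel_measurable M"
        using cadlag_process_at_random_time[OF Xn T meas(1) measurable_ident, of n]
          cadlag_process_at_random_time[OF Xn T meas(2) measurable_ident, of n] range by auto
      have osc_meas[measurable]: "osc n \<sigma> \<nu> \<in> sets M" unfolding osc_def by measurable
      have "ereal (prob (osc n \<sigma> \<nu>)) \<le> W \<delta> n"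
        unfolding W_def by (rule SUP_upper2[of "(\<sigma>, \<nu>)"]) (use \<sigma> \<nu> le in auto)
      then have osc: "prob (osc n \<sigma> \<nu>) < p" using elim(1) by (metis ereal_less_le less_ereal.simps(1) order.strict_trans1)
      have g_meas: "(\<lambda>\<omega>. \<gamma> (\<sigma> \<omega>, Xn n (\<sigma> \<omega>) \<omega>)) \<in> borel_measurable M"
        "(\<lambda>\<omega>. \<gamma> (\<nu> \<omega>, Xn n (\<nu> \<omega>) \<omega>)) \<in> borel_measurable M"
        using reward_at_random_time_measurable[OF Xn T cont meas(1) measurable_ident, of n]
          reward_at_random_time_measurable[OF Xn T cont meas(2) measurable_ident, of n] range by auto
      have int: "integrable M (\<lambda>\<omega>. \<gamma> (\<sigma> \<omega>, Xn n (\<sigma> \<omega>) \<omega>))" "integrable M (\<lambda>\<omega>. \<gamma> (\<nu> \<omega>, Xn n (\<nu> \<omega>) \<omega>))"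
        by (rule integrable_const_bound[of _ C]; use C range g_meas in auto)+
      let ?E = "\<lambda>i::nat. if i = 0 then A else if i = 1 then ?D n else osc n \<sigma> \<nu>"
      let ?N = "\<lambda>\<omega>. \<Sum>i\<in>{0, 1, 2}. indicator (?E i) \<omega> :: real"
      let ?b = "\<lambda>\<omega>. e / 2 + 2 * C * ?N \<omega>"
      have E: "?E i \<in> sets M" for i using A D osc_meas by simp
      have int_b: "integrable M ?b" by (intro expectation_affine_indicators E) simp
      have "(\<integral>\<omega>. \<gamma> (\<sigma> \<omega>, Xn n (\<sigma> \<omega>) \<omega>) \<partial>M) \<le> (\<integral>\<omega>. \<gamma> (\<nu> \<omega>, Xn n (\<nu> \<omega>) \<omega>) + ?b \<omega> \<partial>M)"
      proof (rule integral_mono[OF int(1) Bochner_Integration.integrable_add[OF int(2) int_b]])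
        fix \<omega> assume \<omega>: "\<omega> \<in> space M"
        have bd: "\<bar>\<gamma> (\<sigma> \<omega>, Xn n (\<sigma> \<omega>) \<omega>)\<bar> \<le> C" "\<bar>\<gamma> (\<nu> \<omega>, Xn n (\<nu> \<omega>) \<omega>)\<bar> \<le> C"
          using C range \<omega> by auto
        show "\<gamma> (\<sigma> \<omega>, Xn n (\<sigma> \<omega>) \<omega>) \<le> \<gamma> (\<nu> \<omega>, Xn n (\<nu> \<omega>) \<omega>) + ?b \<omega>"
        proof (cases "\<omega> \<in> A \<or> \<omega> \<in> ?D n \<or> \<omega> \<in> osc n \<sigma> \<nu>")
          case True
          then have "1 \<le> ?N \<omega>"
            by (auto split: split_indicator)
          then have "2 * C * 1 \<le> 2 * C * ?N \<omega>"
            using C0 by (intro mult_left_mono) auto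
          then show ?thesis using bd e by linarith
        next
          case False
          then have X_le: "\<And>t. t \<in> {0..T} \<Longrightarrow> \<bar>X t \<omega>\<bar> \<le> K"
            and d: "skorokhod_dist T (\<lambda>t. Xn n t \<omega>) (\<lambda>t. X t \<omega>) < 1"
            and close: "\<bar>Xn n (\<sigma> \<omega>) \<omega> - Xn n (\<nu> \<omega>) \<omega>\<bar> < \<eta> / 2"
            using \<omega> by (auto simp: A_def osc_def not_less)
          have "cadlag_on T (\<lambda>t. Xn n t \<omega>)" using Xn \<omega> by (auto simp: cadlag_process_def)
          then obtain K' where K': "\<And>t. t \<in> {0..T} \<Longrightarrow> \<bar>Xn n t \<omega>\<bar> \<le> K'"
            using cadlag_bounded[OF _ T] by metis
          obtain l where l: "l \<in> time_changes T"
            "\<And>t. t \<in> {0..T} \<Longrightarrow> \<bar>l t - t\<bar> < 1 \<and> \<bar>Xn n t \<omega> - X (l t) \<omega>\<bar> < 1"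
            using skorokhod_dist_lessD[OF T _ _ d, of "max K K'"] X_le K'
            by (metis max.coboundedI1 max.coboundedI2)
          have Xn_le: "\<bar>Xn n t \<omega>\<bar> \<le> K + 1" if "t \<in> {0..T}" for t
            using l(2)[OF that] X_le[OF time_change_mem[OF l(1) that]] by linarith
          have "dist (\<sigma> \<omega>, Xn n (\<sigma> \<omega>) \<omega>) (\<nu> \<omega>, Xn n (\<nu> \<omega>) \<omega>) < \<eta>"
            using dist_Pair_le[of "\<sigma> \<omega>" "Xn n (\<sigma> \<omega>) \<omega>" "\<nu> \<omega>" "Xn n (\<nu> \<omega>) \<omega>"] le \<omega> \<delta>(3) close by fastforce
          then have "dist (\<gamma> (\<sigma> \<omega>, Xn n (\<sigma> \<omega>) \<omega>)) (\<gamma> (\<nu> \<omega>, Xn n (\<nu> \<omega>) \<omega>)) < e / 2"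
            using range[OF \<omega>] Xn_le[OF range(1)[OF \<omega>]] Xn_le[OF range(2)[OF \<omega>]]
            by (intro \<eta>(2)) auto
          moreover have "0 \<le> 2 * C * ?N \<omega>"
            using C0 by (intro mult_nonneg_nonneg sum_nonneg) auto
          ultimately show ?thesis unfolding dist_real_def by linarith
        qed
      qed
      also have "\<dots> = (\<integral>\<omega>. \<gamma> (\<nu> \<omega>, Xn n (\<nu> \<omega>) \<omega>) \<partial>M) + expectation ?b"
        by (rule Bochner_Integration.integral_add[OF int(2) int_b])
      also have "expectation ?b = e / 2 + 2 * C * (\<Sum>i\<in>{0, 1, 2}. prob (?E i))"
        by (intro expectation_affine_indicators E) simp
      also have "\<dots> \<le> e / 2 + 2 * C * (p + p + p)"
        using C0 K elim(2) osc by (intro add_mono mult_left_mono) (auto simp: A_def[symmetric])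
      also have "\<dots> \<le> e" using Cp by (simp add: algebra_simps)
      finally show "(\<integral>\<omega>. \<gamma> (\<sigma> \<omega>, Xn n (\<sigma> \<omega>) \<omega>) \<partial>M) \<le> (\<integral>\<omega>. \<gamma> (\<nu> \<omega>, Xn n (\<nu> \<omega>) \<omega>) \<partial>M) + e"
        by simp
    qed
  qed
  with \<delta>(1) show ?thesis by (rule that)
qed

section \<open>Convergence of the optimal values\<close>

theorem theorem11:
  fixes M :: "'a measure" and T :: real
    and X :: "real \<Rightarrow> 'a \<Rightarrow> real" and Xn :: "nat \<Rightarrow> real \<Rightarrow> 'a \<Rightarrow> real"
    and \<gamma> :: "real \<times> real \<Rightarrow> real"
  assumes "prob_space M" and "T > 0"
    and "cadlag_process M T X"
    and "\<And>n. cadlag_process M T (Xn n)"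
    and "continuous_on ({0..T} \<times> UNIV) \<gamma>"
    and "bounded (\<gamma> ` ({0..T} \<times> UNIV))"
    and "skorokhod_tendsto_in_prob M T Xn X"
    and "aldous_criterion M T Xn"
    and "\<And>n t. t \<in> {0..T} \<Longrightarrow>
           sets (natural_filtration M (Xn n) t) \<subseteq> sets (right_cont_filtration M T X t)"
  shows "limsup (\<lambda>n. optimal_value M T (natural_filtration M (Xn n)) \<gamma> (Xn n))
           \<le> optimal_value M T (right_cont_filtration M T X) \<gamma> X"
proof -
  interpret prob_space M by fact
  note T = \<open>T > 0\<close> and X = \<open>cadlag_process M T X\<close> and Xn = assms(4) and cont = assms(5)
    and conv = assms(7) and aldous = assms(8)
  let ?S = "\<lambda>n. stopping_times_upto M T (natural_filtration M (Xn n))"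
  let ?SX = "stopping_times_upto M T (right_cont_filtration M T X)"
  let ?V = "optimal_value M T (right_cont_filtration M T X) \<gamma> X"
  let ?Vn = "\<lambda>n. optimal_value M T (natural_filtration M (Xn n)) \<gamma> (Xn n)"
  obtain C where C: "\<And>t z. t \<in> {0..T} \<Longrightarrow> \<bar>\<gamma> (t, z)\<bar> \<le> C"
    using assms(6) unfolding bounded_iff by force
  have inclusion: "?S n \<subseteq> ?SX" for n
    by (rule stopping_times_upto_mono)
      (use assms(9) in \<open>auto simp: space_natural_filtration space_right_cont_filtration\<close>)
  have zero: "(\<lambda>_. 0) \<in> ?S n" for n
    using T by (simp add: stopping_times_upto_def stopping_time_const)
  have range: "\<tau> \<omega> \<in> {0..T}" if "\<tau> \<in> ?S n" "\<omega> \<in> space M" for n \<tau> \<omega>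
    using that by (simp add: stopping_times_upto_def)
  have "\<bar>?V\<bar> \<noteq> \<infinity>"
  proof -
    have "expectation (\<lambda>\<omega>. \<gamma> (\<tau> \<omega>, X (\<tau> \<omega>) \<omega>)) \<le> C" if "\<tau> \<in> ?SX" for \<tau>
    proof -
      have "expectation (\<lambda>\<omega>. \<gamma> (\<tau> \<omega>, X (\<tau> \<omega>) \<omega>)) \<le> expectation (\<lambda>\<omega>. C)"
        by (rule integral_mono') (use that C[of 0 0] T C in \<open>fastforce simp: stopping_times_upto_def abs_le_iff\<close>)+
      then show ?thesis by (simp add: prob_space)
    qed
    then have "?V \<le> ereal C" unfolding optimal_value_def by (intro SUP_least) auto
    moreover have "ereal (expectation (\<lambda>\<omega>. \<gamma> (0, X 0 \<omega>))) \<le> ?V"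
      unfolding optimal_value_def using zero[of 0] inclusion[of 0] by (intro SUP_upper2[of "\<lambda>_. 0"]) auto
    ultimately show ?thesis by auto
  qed
  then obtain g where g: "?V = ereal g" by (cases ?V) auto
  have V_bound: "expectation (\<lambda>\<omega>. \<gamma> (\<tau> \<omega>, X (\<tau> \<omega>) \<omega>)) \<le> g" if "\<tau> \<in> ?SX" for \<tau>
  proof -
    have "ereal (expectation (\<lambda>\<omega>. \<gamma> (\<tau> \<omega>, X (\<tau> \<omega>) \<omega>))) \<le> ?V"
      unfolding optimal_value_def by (rule SUP_upper2[OF that]) simp
    then show ?thesis by (simp add: g)
  qed
  have "limsup ?Vn \<le> ereal (g + 2 * e)" if e: "e > 0" for e
  proof -
    let ?gain = "\<lambda>n \<tau>. expectation (\<lambda>\<omega>. \<gamma> (\<tau> \<omega>, Xn n (\<tau> \<omega>) \<omega>))"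
    \<comment> \<open>Either some \<open>\<F>\<^sup>n\<close>-stopping time beats \<open>g + 2 e\<close> and then \<open>\<tau> n\<close> is one of these, or none does; so it suffices to show that eventually \<open>\<tau> n\<close> does not.\<close>
    define better where "better n \<sigma> \<longleftrightarrow> g + 2 * e < ?gain n \<sigma>" for n \<sigma>
    have "\<exists>\<tau>. \<tau> \<in> ?S n \<and> (\<forall>\<sigma>\<in>?S n. better n \<sigma> \<longrightarrow> better n \<tau>)" for n
      using zero[of n] by blast
    then have "\<exists>\<tau>. \<forall>n. \<tau> n \<in> ?S n \<and> (\<forall>\<sigma>\<in>?S n. better n \<sigma> \<longrightarrow> better n (\<tau> n))"
      by (intro choice allI)
    then obtain \<tau> where \<tau>: "\<And>n. \<tau> n \<in> ?S n"
      and \<tau>_best: "\<And>n \<sigma>. \<sigma> \<in> ?S n \<Longrightarrow> better n \<sigma> \<Longrightarrow> better n (\<tau> n)"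
      by blast
    obtain \<delta> where \<delta>: "\<delta> > 0" and insensitive:
      "\<forall>\<^sub>F n in sequentially. \<forall>\<sigma>\<in>?S n. \<forall>\<nu>\<in>?S n.
       (\<forall>\<omega>\<in>space M. \<sigma> \<omega> \<le> \<nu> \<omega> \<and> \<nu> \<omega> \<le> \<sigma> \<omega> + \<delta>) \<longrightarrow> ?gain n \<sigma> \<le> ?gain n \<nu> + e"
      using aldous_reward_insensitive_to_delay[OF T X Xn cont C conv aldous e] by blast
    define U where "U = uniform_measure lborel {0..\<delta>}"
    interpret U: prob_space U unfolding U_def by (rule prob_space_uniform_measure) (use \<delta> in auto)
    interpret UM: pair_prob_space U M by unfold_locales
    have sets_U: "sets U = sets borel" by (simp add: U_def)
    have AE_U: "AE u in U. u \<in> {0..\<delta>}" unfolding U_def by (rule AE_uniform_measureI) auto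
    define \<nu> where "\<nu> n u \<omega> = delay T (\<tau> n \<omega>) u" for n u \<omega>
    have \<nu>: "\<nu> n u \<in> ?S n" for n u
      unfolding \<nu>_def[abs_def] by (rule delayed_stopping_time[OF \<tau>])
    define a where "a n u \<omega> = \<gamma> (\<nu> n u \<omega>, Xn n (\<nu> n u \<omega>) \<omega>)" for n u \<omega>
    define b where "b n u \<omega> = \<gamma> (\<nu> n u \<omega>, X (\<nu> n u \<omega>) \<omega>)" for n u \<omega>
    have bound: "\<bar>a n u \<omega>\<bar> \<le> C" "\<bar>b n u \<omega>\<bar> \<le> C" if "\<omega> \<in> space M" for n u \<omega>
      using C range[OF \<nu> that] by (auto simp: a_def b_def)
    have [measurable]: "\<tau> n \<in> borel_measurable M" for n
      by (rule stopping_times_upto_measurable[OF \<tau> Xn])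
    have [measurable_cong]: "sets U = sets borel" by (rule sets_U)
    have \<nu>_meas: "(\<lambda>p. \<nu> n (fst p) (snd p)) \<in> borel_measurable (U \<Otimes>\<^sub>M M)" for n
      unfolding \<nu>_def delay_def by measurable
    have \<nu>_range: "\<nu> n (fst p) (snd p) \<in> {0..T}" if "p \<in> space (U \<Otimes>\<^sub>M M)" for n p
      using range[OF \<nu>, of "snd p" n "fst p"] that by (auto simp: space_pair_measure)
    have a_meas: "(\<lambda>p. a n (fst p) (snd p)) \<in> borel_measurable (U \<Otimes>\<^sub>M M)" for n
      unfolding a_def by (rule reward_at_random_time_measurable[OF Xn T cont \<nu>_meas measurable_snd \<nu>_range])
    have b_meas: "(\<lambda>p. b n (fst p) (snd p)) \<in> borel_measurable (U \<Otimes>\<^sub>M M)" for n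
      unfolding b_def by (rule reward_at_random_time_measurable[OF X T cont \<nu>_meas measurable_snd \<nu>_range])
    have ab_split: "(\<lambda>(u, \<omega>). a n u \<omega>) \<in> borel_measurable (U \<Otimes>\<^sub>M M)"
      "(\<lambda>(u, \<omega>). b n u \<omega>) \<in> borel_measurable (U \<Otimes>\<^sub>M M)" for n
      using a_meas[of n] b_meas[of n] by (simp_all add: case_prod_beta')
    \<comment> \<open>The averaged gap between the rewards along \<open>X\<^sup>n\<close> and along \<open>X\<close>; its expectation tends to \<open>0\<close>.\<close>
    define L where "L n \<omega> = (\<integral>u. \<bar>a n u \<omega> - b n u \<omega>\<bar> \<partial>U)" for n \<omega>
    have ab_meas: "(\<lambda>(u, \<omega>). \<bar>a n u \<omega> - b n u \<omega>\<bar>) \<in> borel_measurable (U \<Otimes>\<^sub>M M)" for n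
      using a_meas[of n] b_meas[of n] by (simp add: case_prod_beta')
    have L_meas: "L n \<in> borel_measurable M" for n
      unfolding L_def using measurable_pair_swap[OF ab_meas[of n]]
      by (intro U.borel_measurable_lebesgue_integral) (simp add: case_prod_beta')
    have L_range: "0 \<le> L n \<omega> \<and> L n \<omega> \<le> 2 * C" if \<omega>: "\<omega> \<in> space M" for n \<omega>
    proof -
      have "L n \<omega> \<le> (\<integral>u. 2 * C \<partial>U)"
        unfolding L_def
      proof (rule integral_mono')
        fix u show "\<bar>a n u \<omega> - b n u \<omega>\<bar> \<le> 2 * C" "0 \<le> 2 * C" using bound[OF \<omega>, of n u] by linarith+
      qed simp
      moreover have "0 \<le> L n \<omega>" unfolding L_def by (rule integral_nonneg_AE) simp
      ultimately show ?thesis using U.prob_space by simp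
    qed
    have "(\<lambda>n. expectation (L n)) \<longlonglongrightarrow> 0"
    proof (rule expectation_tendsto_0_of_pathwise_modulus[OF skorokhod_dist_measurable[OF Xn X T] L_meas L_range])
      show "(\<lambda>n. prob {\<omega>\<in>space M. c \<le> skorokhod_dist T (\<lambda>t. Xn n t \<omega>) (\<lambda>t. X t \<omega>)}) \<longlonglongrightarrow> 0" if "c > 0" for c
        using conv that by (simp add: skorokhod_tendsto_in_prob_def)
      fix \<omega> \<rho> assume \<omega>: "\<omega> \<in> space M" and \<rho>: "\<rho> > (0::real)"
      have cad: "cadlag_on T (\<lambda>t. X t \<omega>)" "cadlag_on T (\<lambda>t. Xn n t \<omega>)" for n
        using X Xn \<omega> by (auto simp: cadlag_process_def)
      obtain \<kappa> where \<kappa>: "\<kappa> > 0" "\<And>y a. cadlag_on T y \<Longrightarrow> skorokhod_dist T y (\<lambda>t. X t \<omega>) < \<kappa> \<Longrightarrow> a \<in> {0..T} \<Longrightarrow>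
      (\<integral>u. \<bar>\<gamma> (delay T a u, y (delay T a u)) - \<gamma> (delay T a u, X (delay T a u) \<omega>)\<bar>
         \<partial>uniform_measure lborel {0..\<delta>}) \<le> \<rho>"
        using averaged_reward_modulus[OF cad(1) T \<delta> \<rho> cont C] by blast
      have "L n \<omega> \<le> \<rho>" if "skorokhod_dist T (\<lambda>t. Xn n t \<omega>) (\<lambda>t. X t \<omega>) < \<kappa>" for n
        using \<kappa>(2)[OF cad(2) that range[OF \<tau> \<omega>]] unfolding L_def a_def b_def \<nu>_def U_def .
      then show "\<exists>\<kappa>>0. \<forall>n. skorokhod_dist T (\<lambda>t. Xn n t \<omega>) (\<lambda>t. X t \<omega>) < \<kappa> \<longrightarrow> L n \<omega> \<le> \<rho>"
        using \<kappa>(1) by blast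
    qed
    from order_tendstoD(2)[OF this e] insensitive
    have "\<forall>\<^sub>F n in sequentially. ?Vn n \<le> ereal (g + 2 * e)"
    proof eventually_elim
      case (elim n)
      have pair_int: "integrable (U \<Otimes>\<^sub>M M) (\<lambda>(u, \<omega>). f u \<omega>)"
        if "(\<lambda>(u, \<omega>). f u \<omega>) \<in> borel_measurable (U \<Otimes>\<^sub>M M)"
          "\<And>u \<omega>. \<omega> \<in> space M \<Longrightarrow> \<bar>f u \<omega>\<bar> \<le> K" for f :: "real \<Rightarrow> 'a \<Rightarrow> real" and K
        using that by (intro UM.integrable_const_bound[of _ K]) (auto simp: space_pair_measure)
      have int_a: "integrable (U \<Otimes>\<^sub>M M) (\<lambda>(u, \<omega>). a n u \<omega>)"
        by (rule pair_int[OF ab_split(1) bound(1)])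
      have int_b: "integrable (U \<Otimes>\<^sub>M M) (\<lambda>(u, \<omega>). b n u \<omega>)"
        by (rule pair_int[OF ab_split(2) bound(2)])
      have gap: "\<bar>\<bar>a n u \<omega> - b n u \<omega>\<bar>\<bar> \<le> 2 * C" if "\<omega> \<in> space M" for u \<omega>
        using bound[OF that, of n u] by linarith
      have int_ab: "integrable (U \<Otimes>\<^sub>M M) (\<lambda>(u, \<omega>). \<bar>a n u \<omega> - b n u \<omega>\<bar>)"
        by (rule pair_int[OF ab_meas gap])
      have "?gain n (\<tau> n) = (\<integral>u. ?gain n (\<tau> n) \<partial>U)" using U.prob_space by simp
      also have "\<dots> \<le> (\<integral>u. (\<integral>\<omega>. a n u \<omega> \<partial>M) + e \<partial>U)"
      proof (rule integral_mono_AE)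
        show "AE u in U. ?gain n (\<tau> n) \<le> (\<integral>\<omega>. a n u \<omega> \<partial>M) + e"
          using AE_U
        proof eventually_elim
          fix u assume u: "u \<in> {0..\<delta>}"
          have "\<tau> n \<omega> \<le> \<nu> n u \<omega> \<and> \<nu> n u \<omega> \<le> \<tau> n \<omega> + \<delta>" if "\<omega> \<in> space M" for \<omega>
            using u range[OF \<tau> that, of n] by (auto simp: \<nu>_def delay_def)
          then show "?gain n (\<tau> n) \<le> (\<integral>\<omega>. a n u \<omega> \<partial>M) + e"
            using elim(2) \<tau> \<nu> unfolding a_def by blast
        qed
      qed (use UM.integrable_fst[OF int_a] in auto)
      also have "\<dots> = (\<integral>u. (\<integral>\<omega>. a n u \<omega> \<partial>M) \<partial>U) + e"
        using UM.integrable_fst[OF int_a] U.prob_space by simp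
      also have "(\<integral>u. (\<integral>\<omega>. a n u \<omega> \<partial>M) \<partial>U) \<le> (\<integral>u. (\<integral>\<omega>. b n u \<omega> \<partial>M) \<partial>U) + expectation (L n)"
      proof -
        have "(\<integral>p. (case p of (u, \<omega>) \<Rightarrow> a n u \<omega>) \<partial>(U \<Otimes>\<^sub>M M)) \<le>
            (\<integral>p. (case p of (u, \<omega>) \<Rightarrow> b n u \<omega>) + (case p of (u, \<omega>) \<Rightarrow> \<bar>a n u \<omega> - b n u \<omega>\<bar>) \<partial>(U \<Otimes>\<^sub>M M))"
          by (rule integral_mono[OF int_a Bochner_Integration.integrable_add[OF int_b int_ab]]) auto
        also have "\<dots> = (\<integral>p. (case p of (u, \<omega>) \<Rightarrow> b n u \<omega>) \<partial>(U \<Otimes>\<^sub>M M)) +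
            (\<integral>p. (case p of (u, \<omega>) \<Rightarrow> \<bar>a n u \<omega> - b n u \<omega>\<bar>) \<partial>(U \<Otimes>\<^sub>M M))"
          by (rule Bochner_Integration.integral_add[OF int_b int_ab])
        finally show ?thesis
          unfolding L_def UM.integral_fst[OF int_a, symmetric] UM.integral_fst[OF int_b, symmetric]
            UM.integral_snd[OF int_ab, symmetric]
          by simp
      qed
      also have "(\<integral>u. (\<integral>\<omega>. b n u \<omega> \<partial>M) \<partial>U) \<le> (\<integral>u. g \<partial>U)"
      proof (rule integral_mono)
        have "\<nu> n u \<in> ?SX" for u using \<nu> inclusion by blast
        then show "(\<integral>\<omega>. b n u \<omega> \<partial>M) \<le> g" for u unfolding b_def by (rule V_bound)
      qed (use UM.integrable_fst[OF int_b] in auto)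
      also have "(\<integral>u. g \<partial>U) = g" using U.prob_space by simp
      finally have "?gain n (\<tau> n) \<le> g + 2 * e" using elim(1) by linarith
      then show ?case
        unfolding optimal_value_def
        using \<tau>_best[of _ n] by (intro SUP_least) (auto simp: better_def not_le[symmetric])
    qed
    then show ?thesis by (rule Limsup_bounded)
  qed
  then have "limsup ?Vn \<le> ?V + ereal e" if "e > 0" for e
    using that[THEN half_gt_zero] by (fastforce simp: g)
  then show ?thesis using ereal_le_epsilon2 by blast
qed

end
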